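(* Let $a<b$, $\mu>1$, $\alpha\in[0,2)$ and let $f\in\mathscr{C}^{\mu}([a,b]^3_<;X_\alpha)$ satisfy $\delta_{S,3}f=0$ on $[a,b]^4_<$. Then there exists a unique function $$M\in\bigcap_{0\le\varepsilon<1}\mathscr{C}^{\mu-\varepsilon}([a,b]^2_<;X_{\alpha+\varepsilon})$$ such that $\hat\delta_2M=\mathbb{S}_3f$ on $[a,b]^3_<$, i.e. $M(r,t)-M(s,t)-S(t-s)M(r,s)=S(t-s)f(r,s,t)$ for every $(r,s,t)\in[a,b]^3_<$. Moreover, for every $\varepsilon\in[0,1)$ there exists a positive constant $C=C(\varepsilon,\alpha,\mu,b-a)$ such that $$\|M\|_{\mathscr{C}^{\mu-\varepsilon}([a,b]^2_<;X_{\alpha+\varepsilon})}\le C\|f\|_{\mathscr{C}^{\mu}([a,b]^3_<;X_\alpha)}.$$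
   Context: Standing assumptions. $X$ is a Banach space and $A:D(A)\subset X\to X$ is the generator of a semigroup $(S(t))_{t\ge0}$ of bounded linear operators on $X$ ($S(0)=I$, $S(t+s)=S(t)S(s)$; continuity of $t\mapsto S(t)x$ at $t=0$ is not required). For every $\lambda\in[0,3)$ there is a Banach space $X_\lambda$, with $X_0=X$ and $X_1=D(A)$, such that $X_\lambda$ is continuously embedded in $X_\beta$ whenever $\beta<\lambda$. For every $T>0$, every $\zeta,\lambda\in[0,3)$ with $\zeta\le\lambda$ and every $\mu,\nu\in[0,1]$ with $\mu>\nu$ there are constants $L_{\zeta,\lambda,T},C_{\mu,\nu,T}>0$ with $\|S(t)\|_{\mathscr{L}(X_\zeta,X_\lambda)}\le L_{\zeta,\lambda,T}t^{-\lambda+\zeta}$ and $\|S(t)-I\|_{\mathscr{L}(X_\mu,X_\nu)}\le C_{\mu,\nu,T}t^{\mu-\nu}$ for every $t\in(0,T]$. Each $S(t)$, $t\ge0$, is injective. Constants in estimates may also depend on these fixed data (the spaces $X_\lambda$, the semigroup and the constants just introduced). Notation. $[a,b]^n_<=\{(t_1,\dots,t_n):a\le t_1\le\dots\le t_n\le b\}$. For $\beta\ge0$: $\mathscr{C}^\beta([a,b]^2_<;X_\alpha)$ is the set of continuous $f:[a,b]^2_<\to X_\alpha$ with $f(s,s)=0$ for all $s$ and $\|f\|=\sup_{a\le s<t\le b}\|f(s,t)\|_{X_\alpha}(t-s)^{-\beta}<\infty$; $\mathscr{C}^\beta([a,b]^3_<;X_\alpha)$ is the set of continuous $f:[a,b]^3_<\to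 X_\alpha$ with $f(r,s,t)=0$ when $r=s$ or $s=t$ and $\|f\|=\sup_{a\le r<s<t\le b}\|f(r,s,t)\|_{X_\alpha}(t-r)^{-\beta}<\infty$. $(\hat\delta_2M)(r,s,t)=M(r,t)-M(s,t)-S(t-s)M(r,s)$; $(\mathbb{S}_3f)(r,s,t)=S(t-s)f(r,s,t)$; $(\delta_{S,3}f)(t_1,t_2,t_3,t_4)=f(t_2,t_3,t_4)-f(t_1,t_3,t_4)+S(t_3-t_2)[f(t_1,t_2,t_4)-f(t_1,t_2,t_3)]$. *)

theory Defs
  imports "HOL-Analysis.Analysis"
begin

subsection \<open>The scale of Banach spaces and the semigroup\<close>

text \<open>Distance induced by a norm \<open>N\<close> on a subspace \<open>V\<close>. It is set to \<open>0\<close> off \<open>V\<close> because the locale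
  \<^locale>\<open>Metric_space\<close> demands nonnegativity and symmetry on the whole type.\<close>

definition ndist :: "'a::real_vector set \<Rightarrow> ('a \<Rightarrow> real) \<Rightarrow> 'a \<Rightarrow> 'a \<Rightarrow> real" where
  "ndist V N x y = (if x \<in> V \<and> y \<in> V then N (x - y) else 0)"

text \<open>A Banach space contained (as a vector space) in the ambient space: a linear subspace \<open>V\<close>
  that is complete for a norm \<open>N\<close> of its own. Values of \<open>N\<close> outside \<open>V\<close> are irrelevant.\<close>

definition banach_on :: "'a::real_vector set \<Rightarrow> ('a \<Rightarrow> real) \<Rightarrow> bool" where
  "banach_on V N \<longleftrightarrow>
     subspace V \<and>
     (\<forall>x\<in>V. 0 \<le> N x \<and> (N x = 0 \<longleftrightarrow> x = 0)) \<and>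
     (\<forall>x\<in>V. \<forall>c. N (c *\<^sub>R x) = \<bar>c\<bar> * N x) \<and>
     (\<forall>x\<in>V. \<forall>y\<in>V. N (x + y) \<le> N x + N y) \<and>
     Metric_space.mcomplete V (ndist V N)"

text \<open>\<open>op_bound V N W N' B K\<close>: the operator \<open>B\<close> maps \<open>V\<close> to \<open>W\<close> with operator norm at most \<open>K\<close>.\<close>

definition op_bound ::
  "'a set \<Rightarrow> ('a \<Rightarrow> real) \<Rightarrow> 'b set \<Rightarrow> ('b \<Rightarrow> real) \<Rightarrow> ('a \<Rightarrow> 'b) \<Rightarrow> real \<Rightarrow> bool" where
  "op_bound V N W N' B K \<longleftrightarrow> (\<forall>x\<in>V. B x \<in> W \<and> N' (B x) \<le> K * N x)"

text \<open>Since \<open>S\<close> need not be strongly continuous at \<open>0\<close>, its generator is the operator \<open>A\<close> with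
  domain \<open>D\<close> whose resolvent is the Laplace transform of \<open>S\<close> on a half-line \<open>(\<omega>, \<infinity>)\<close>. For strongly
  continuous semigroups this is the usual infinitesimal generator. As no separability is assumed,
  the integral is the Henstock-Kurzweil integral.\<close>

definition generates :: "'a set \<Rightarrow> ('a \<Rightarrow> 'a) \<Rightarrow> (real \<Rightarrow> 'a \<Rightarrow> 'a::banach) \<Rightarrow> bool" where
  "generates D A S \<longleftrightarrow>
     subspace D \<and>
     (\<forall>x\<in>D. \<forall>y\<in>D. A (x + y) = A x + A y) \<and>
     (\<forall>x\<in>D. \<forall>c. A (c *\<^sub>R x) = c *\<^sub>R A x) \<and>
     (\<exists>\<omega>. \<forall>z>\<omega>. \<exists>R. bounded_linear R \<and>
        (\<forall>y. R y \<in> D \<and> z *\<^sub>R R y - A (R y) = y) \<and>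
        (\<forall>x\<in>D. R (z *\<^sub>R x - A x) = x) \<and>
        (\<forall>y. ((\<lambda>t. exp (- (z * t)) *\<^sub>R S t y) has_integral R y) {0..}))"

text \<open>\<open>X \<gamma>\<close> with norm \<open>N \<gamma>\<close>, for \<open>0 \<le> \<gamma> < 3\<close>, is the scale of spaces inside \<open>'a = X 0\<close>; the
  embeddings are inclusions. The identity \<open>X 1 = D\<close> is one of Banach spaces up to equivalence
  with the graph norm of \<open>A\<close>.\<close>

locale smoothing_semigroup =
  fixes X :: "real \<Rightarrow> 'a::banach set"
    and N :: "real \<Rightarrow> 'a \<Rightarrow> real"
    and D :: "'a set"
    and A :: "'a \<Rightarrow> 'a"
    and S :: "real \<Rightarrow> 'a \<Rightarrow> 'a"
  assumes S_bounded_linear: "\<And>t. 0 \<le> t \<Longrightarrow> bounded_linear (S t)"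
    and S_zero: "\<And>x. S 0 x = x"
    and S_add: "\<And>s t x. 0 \<le> s \<Longrightarrow> 0 \<le> t \<Longrightarrow> S (t + s) x = S t (S s x)"
    and S_inj: "\<And>t. 0 \<le> t \<Longrightarrow> inj (S t)"
    and generator: "generates D A S"
    and X_banach: "\<And>\<gamma>. 0 \<le> \<gamma> \<Longrightarrow> \<gamma> < 3 \<Longrightarrow> banach_on (X \<gamma>) (N \<gamma>)"
    and X_0: "X 0 = UNIV" "N 0 = norm"
    and X_1: "X 1 = D"
      "\<exists>c>0. \<exists>K>0. \<forall>x\<in>D. c * (norm x + norm (A x)) \<le> N 1 x \<and> N 1 x \<le> K * (norm x + norm (A x))"
    and X_embed: "\<And>\<beta> \<gamma>. 0 \<le> \<beta> \<Longrightarrow> \<beta> < \<gamma> \<Longrightarrow> \<gamma> < 3 \<Longrightarrow>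
      \<exists>K>0. op_bound (X \<gamma>) (N \<gamma>) (X \<beta>) (N \<beta>) (\<lambda>x. x) K"
    and S_smoothing: "\<And>T \<zeta> \<gamma>. 0 < T \<Longrightarrow> 0 \<le> \<zeta> \<Longrightarrow> \<zeta> \<le> \<gamma> \<Longrightarrow> \<gamma> < 3 \<Longrightarrow>
      \<exists>L>0. \<forall>t\<in>{0<..T}. op_bound (X \<zeta>) (N \<zeta>) (X \<gamma>) (N \<gamma>) (S t) (L * t powr (- \<gamma> + \<zeta>))"
    and S_near_id: "\<And>T \<mu> \<nu>. 0 < T \<Longrightarrow> 0 \<le> \<nu> \<Longrightarrow> \<nu> < \<mu> \<Longrightarrow> \<mu> \<le> 1 \<Longrightarrow>
      \<exists>C>0. \<forall>t\<in>{0<..T}. op_bound (X \<mu>) (N \<mu>) (X \<nu>) (N \<nu>) (\<lambda>x. S t x - x) (C * t powr (\<mu> - \<nu>))"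


subsection \<open>Hoelder spaces of increments on simplices\<close>

definition simplex2 :: "real \<Rightarrow> real \<Rightarrow> (real \<times> real) set" where
  "simplex2 a b = {(s, t). a \<le> s \<and> s \<le> t \<and> t \<le> b}"

definition simplex3 :: "real \<Rightarrow> real \<Rightarrow> (real \<times> real \<times> real) set" where
  "simplex3 a b = {(r, s, t). a \<le> r \<and> r \<le> s \<and> s \<le> t \<and> t \<le> b}"

definition simplex4 :: "real \<Rightarrow> real \<Rightarrow> (real \<times> real \<times> real \<times> real) set" where
  "simplex4 a b =
     {(t1, t2, t3, t4). a \<le> t1 \<and> t1 \<le> t2 \<and> t2 \<le> t3 \<and> t3 \<le> t4 \<and> t4 \<le> b}"

definition quotients2 ::
  "('a \<Rightarrow> real) \<Rightarrow> real \<Rightarrow> real \<Rightarrow> real \<Rightarrow> (real \<times> real \<Rightarrow> 'a) \<Rightarrow> real set" where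
  "quotients2 N \<beta> a b f = {N (f (s, t)) * (t - s) powr (- \<beta>) | s t. a \<le> s \<and> s < t \<and> t \<le> b}"

definition quotients3 ::
  "('a \<Rightarrow> real) \<Rightarrow> real \<Rightarrow> real \<Rightarrow> real \<Rightarrow> (real \<times> real \<times> real \<Rightarrow> 'a) \<Rightarrow> real set" where
  "quotients3 N \<beta> a b f =
     {N (f (r, s, t)) * (t - r) powr (- \<beta>) | r s t. a \<le> r \<and> r < s \<and> s < t \<and> t \<le> b}"

definition holder_norm2 ::
  "('a \<Rightarrow> real) \<Rightarrow> real \<Rightarrow> real \<Rightarrow> real \<Rightarrow> (real \<times> real \<Rightarrow> 'a) \<Rightarrow> real" where
  "holder_norm2 N \<beta> a b f = Sup (quotients2 N \<beta> a b f)"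

definition holder_norm3 ::
  "('a \<Rightarrow> real) \<Rightarrow> real \<Rightarrow> real \<Rightarrow> real \<Rightarrow> (real \<times> real \<times> real \<Rightarrow> 'a) \<Rightarrow> real" where
  "holder_norm3 N \<beta> a b f = Sup (quotients3 N \<beta> a b f)"

text \<open>Functions defined on a simplex are encoded as \<^const>\<open>extensional\<close> functions, so that equality of
  functions is equality on the simplex. Continuity is with respect to the norm \<open>N\<close> of the target
  space \<open>V\<close>, and \<^const>\<open>continuous_map\<close> entails that the values on the simplex lie in \<open>V\<close>.\<close>

definition holder2 ::
  "'a::real_vector set \<Rightarrow> ('a \<Rightarrow> real) \<Rightarrow> real \<Rightarrow> real \<Rightarrow> real \<Rightarrow> (real \<times> real \<Rightarrow> 'a) set" where
  "holder2 V N \<beta> a b =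
     {f \<in> extensional (simplex2 a b).
        continuous_map (top_of_set (simplex2 a b)) (Metric_space.mtopology V (ndist V N)) f \<and>
        (\<forall>s\<in>{a..b}. f (s, s) = 0) \<and>
        bdd_above (quotients2 N \<beta> a b f)}"

definition holder3 ::
  "'a::real_vector set \<Rightarrow> ('a \<Rightarrow> real) \<Rightarrow> real \<Rightarrow> real \<Rightarrow> real \<Rightarrow> (real \<times> real \<times> real \<Rightarrow> 'a) set" where
  "holder3 V N \<beta> a b =
     {f \<in> extensional (simplex3 a b).
        continuous_map (top_of_set (simplex3 a b)) (Metric_space.mtopology V (ndist V N)) f \<and>
        (\<forall>(r, s, t)\<in>simplex3 a b. r = s \<or> s = t \<longrightarrow> f (r, s, t) = 0) \<and>
        bdd_above (quotients3 N \<beta> a b f)}"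

definition delta_hat2 ::
  "(real \<Rightarrow> 'a \<Rightarrow> 'a::real_vector) \<Rightarrow> (real \<times> real \<Rightarrow> 'a) \<Rightarrow> real \<times> real \<times> real \<Rightarrow> 'a" where
  "delta_hat2 S M = (\<lambda>(r, s, t). M (r, t) - M (s, t) - S (t - s) (M (r, s)))"

definition S_op3 ::
  "(real \<Rightarrow> 'a \<Rightarrow> 'a) \<Rightarrow> (real \<times> real \<times> real \<Rightarrow> 'a) \<Rightarrow> real \<times> real \<times> real \<Rightarrow> 'a" where
  "S_op3 S f = (\<lambda>(r, s, t). S (t - s) (f (r, s, t)))"

definition delta_S3 ::
  "(real \<Rightarrow> 'a \<Rightarrow> 'a::real_vector) \<Rightarrow> (real \<times> real \<times> real \<Rightarrow> 'a) \<Rightarrow>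
    real \<times> real \<times> real \<times> real \<Rightarrow> 'a" where
  "delta_S3 S f = (\<lambda>(t1, t2, t3, t4).
     f (t2, t3, t4) - f (t1, t3, t4) + S (t3 - t2) (f (t1, t2, t4) - f (t1, t2, t3)))"

end

theory Submission
  imports Defs
begin

text \<open>
  With \<open>h (s, t) = - S (t - s) (f (a, s, t))\<close> the cocycle condition makes \<open>h\<close> a solution of
  \<open>delta_hat2 S h = S_op3 S f\<close>, and solutions differ by increments \<open>F t - S (t - s) (F s)\<close>. To
  correct \<open>h\<close> to a regular solution \<open>M\<close>, subtract the limit of the Riemann sums
  \<open>\<Sum>\<^sub>k S (t - t\<^sub>k\<^sub>+\<^sub>1) (h (t\<^sub>k, t\<^sub>k\<^sub>+\<^sub>1))\<close>: inserting a point \<open>m\<close> between \<open>u\<close> and \<open>v\<close> changes such a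
  sum by \<open>S (t - m) (f (u, m, v))\<close>, which is of order \<open>(v - u)\<^sup>\<mu>\<close> with \<open>\<mu> > 1\<close>.

  Existence uses the partitions cut out of \<open>[s, t]\<close> by one fixed dyadic partition of \<open>[a, b]\<close>, for
  which the additivity of the limit in the interval is immediate; the norm of \<open>X 0\<close> suffices there.
  These partitions are useless in \<open>X (\<alpha> + \<epsilon>)\<close>, because a new point \<open>m\<close> may come too close to \<open>t\<close> for
  the singularity \<open>(t - m) powr - \<epsilon>\<close> of the semigroup. But once a solution with
  \<open>norm (M (s, t)) \<le> C * (t - s) powr \<kappa>\<close>, \<open>\<kappa> > 1\<close>, is known, the Riemann sums of \<open>M\<close> itself along the
  dyadic partitions of \<open>[s, t]\<close> tend to \<open>0\<close>, so that \<open>M (s, t) = \<Sum>\<^sub>n \<Sum>\<^sub>k S (t - m) (f (u, m, v))\<close> over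
  the dyadic intervals of \<open>[s, t]\<close>. This formula gives uniqueness, and it converges geometrically in
  \<open>X (\<alpha> + \<epsilon>)\<close>, which gives the estimate and the continuity.
\<close>

subsection \<open>Sums of powers\<close>

lemma powr_dyadic:
  assumes "0 \<le> (l::real)"
  shows "(l / 2 ^ n) powr \<theta> = l powr \<theta> * ((1/2) powr \<theta>) ^ n"
proof -
  have "(l / 2 ^ n) powr \<theta> = (l * (1/2) ^ n) powr \<theta>"
    by (simp add: power_one_over)
  also have "\<dots> = l powr \<theta> * ((1/2) ^ n) powr \<theta>"
    using assms by (simp add: powr_mult)
  also have "((1/2::real) ^ n) powr \<theta> = ((1/2) powr \<theta>) ^ n"
    by (induction n) (simp_all add: powr_mult powr_divide)
  finally show ?thesis .
qed

lemma half_powr_less_1: "0 < \<theta> \<Longrightarrow> (1/2::real) powr \<theta> < 1"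
  using powr_less_mono2[of \<theta> "1/2" 1] by simp

text \<open>The exponent \<mu> is split into \<mu> - \<kappa>, \<kappa> - 1 and 1: the mesh bounds
  the first factor, the total length the second, and the third telescopes. With \<kappa> = 1 all
  surplus goes into decay in the mesh; with \<kappa> > 1 a power of the length above 1
  survives.\<close>

lemma sum_gaps_powr_le:
  fixes p :: "nat \<Rightarrow> real"
  assumes p: "mono p"
    and gap: "\<And>k. k < m \<Longrightarrow> p (Suc k) - p k \<le> \<delta>"
    and \<kappa>: "1 \<le> \<kappa>" "\<kappa> \<le> \<mu>"
  shows "(\<Sum>k<m. (p (Suc k) - p k) powr \<mu>) \<le> \<delta> powr (\<mu> - \<kappa>) * (p m - p 0) powr \<kappa>"
proof -
  have "(p (Suc k) - p k) powr \<mu> \<le>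
      \<delta> powr (\<mu> - \<kappa>) * (p m - p 0) powr (\<kappa> - 1) * (p (Suc k) - p k)" if k: "k < m" for k
  proof -
    let ?g = "p (Suc k) - p k"
    have g0: "0 \<le> ?g" by (simp add: monoD[OF p])
    have "p 0 \<le> p k" "p (Suc k) \<le> p m" using k by (simp_all add: monoD[OF p])
    then have gl: "?g \<le> p m - p 0" by simp
    have "?g powr \<mu> = ?g powr (\<mu> - \<kappa>) * ?g powr (\<kappa> - 1) * ?g powr 1"
      unfolding powr_add[symmetric] by simp
    also have "\<dots> \<le> \<delta> powr (\<mu> - \<kappa>) * (p m - p 0) powr (\<kappa> - 1) * ?g powr 1"
      using g0 gl gap[OF k] \<kappa> by (intro mult_mono powr_mono2) auto
    finally show ?thesis using g0 by simp
  qed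
  then have "(\<Sum>k<m. (p (Suc k) - p k) powr \<mu>) \<le>
      (\<Sum>k<m. \<delta> powr (\<mu> - \<kappa>) * (p m - p 0) powr (\<kappa> - 1) * (p (Suc k) - p k))"
    by (intro sum_mono) auto
  also have "\<dots> = \<delta> powr (\<mu> - \<kappa>) * ((p m - p 0) powr (\<kappa> - 1) * (p m - p 0))"
    by (simp only: sum_distrib_left[symmetric] sum_lessThan_telescope mult.assoc)
  also have "(p m - p 0) powr (\<kappa> - 1) * (p m - p 0) = (p m - p 0) powr \<kappa>"
    using monoD[OF p, of 0 m] by (cases "p m = p 0") (simp_all add: powr_diff)
  finally show ?thesis .
qed

text \<open>Comparison with the integral of \<open>x powr - \<epsilon>\<close>, finite at 0 for
  \<epsilon> < 1: each increment of the primitive dominates the next summand. It absorbs the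
  singularity of the semigroup in \<open>dyadic_level_estimate\<close>.\<close>

lemma sum_powr_neg_le:
  fixes \<epsilon> :: real
  assumes "0 \<le> \<epsilon>" "\<epsilon> < 1"
  shows "(\<Sum>i<m. real (Suc i) powr - \<epsilon>) \<le> real m powr (1 - \<epsilon>) / (1 - \<epsilon>)"
proof (induction m)
  case (Suc m)
  have "(1 - \<epsilon>) * real (Suc m) powr - \<epsilon> \<le> real (Suc m) powr (1 - \<epsilon>) - real m powr (1 - \<epsilon>)"
  \<comment> \<open>The mean value theorem is applied away from 0, where the power is
    differentiable. For m = 0 the claim reads 1 - \<epsilon> \<le> 1.\<close>
  proof (cases "m = 0")
    case False
    have "\<exists>z. real m < z \<and> z < real (Suc m) \<and>
        real (Suc m) powr (1 - \<epsilon>) - real m powr (1 - \<epsilon>) =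
        (real (Suc m) - real m) * ((1 - \<epsilon>) * z powr (1 - \<epsilon> - 1))"
      using False by (intro MVT2) (auto intro!: has_real_derivative_powr[THEN DERIV_cong])
    then obtain z where z: "real m < z" "z < real (Suc m)"
      and eq: "real (Suc m) powr (1 - \<epsilon>) - real m powr (1 - \<epsilon>) = (1 - \<epsilon>) * z powr - \<epsilon>"
      by auto
    have "real (Suc m) powr - \<epsilon> \<le> z powr - \<epsilon>"
      using z assms by (intro powr_mono2') auto
    then show ?thesis using eq assms by simp
  qed (use assms in auto)
  then have "real (Suc m) powr - \<epsilon> \<le>
      (real (Suc m) powr (1 - \<epsilon>) - real m powr (1 - \<epsilon>)) / (1 - \<epsilon>)"
    using assms by (simp add: field_simps)
  then show ?case using Suc by (simp add: diff_divide_distrib)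
qed simp

subsection \<open>Banach subspaces and Hoelder spaces\<close>

lemma banach_on_props:
  assumes "banach_on V N"
  shows "subspace V" "\<And>x. x \<in> V \<Longrightarrow> 0 \<le> N x" "\<And>x. x \<in> V \<Longrightarrow> N x = 0 \<longleftrightarrow> x = 0" "N 0 = 0"
    "\<And>x y. x \<in> V \<Longrightarrow> y \<in> V \<Longrightarrow> N (x + y) \<le> N x + N y"
    "\<And>x y. x \<in> V \<Longrightarrow> y \<in> V \<Longrightarrow> N (x - y) = N (y - x)"
    "Metric_space V (ndist V N)"
proof -
  show V: "subspace V" and nonneg: "\<And>x. x \<in> V \<Longrightarrow> 0 \<le> N x"
    and zero: "\<And>x. x \<in> V \<Longrightarrow> N x = 0 \<longleftrightarrow> x = 0"
    and tri: "\<And>x y. x \<in> V \<Longrightarrow> y \<in> V \<Longrightarrow> N (x + y) \<le> N x + N y"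
    using assms unfolding banach_on_def by blast+
  show "N 0 = 0" using zero[of 0] subspace_0[OF V] by simp
  have scale: "\<And>x c. x \<in> V \<Longrightarrow> N (c *\<^sub>R x) = \<bar>c\<bar> * N x"
    using assms unfolding banach_on_def by blast
  show sym: "N (x - y) = N (y - x)" if "x \<in> V" "y \<in> V" for x y
    using scale[of "x - y" "-1"] subspace_diff[OF V that] by simp
  show "Metric_space V (ndist V N)"
  proof
    fix x y z
    show "0 \<le> ndist V N x y" using nonneg subspace_diff[OF V] by (simp add: ndist_def)
    show "ndist V N x y = ndist V N y x" using sym by (simp add: ndist_def)
    assume x: "x \<in> V" and y: "y \<in> V"
    show "ndist V N x y = 0 \<longleftrightarrow> x = y"
      using x y zero[of "x - y"] subspace_diff[OF V] by (simp add: ndist_def)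
    assume z: "z \<in> V"
    show "ndist V N x z \<le> ndist V N x y + ndist V N y z"
      using x y z tri[of "x - y" "y - z"] subspace_diff[OF V] by (simp add: ndist_def)
  qed
qed

lemma banach_on_sum_le:
  assumes V: "banach_on V N" and "\<And>i. i \<in> I \<Longrightarrow> g i \<in> V"
  shows "(\<Sum>i\<in>I. g i) \<in> V" "N (\<Sum>i\<in>I. g i) \<le> (\<Sum>i\<in>I. N (g i))"
proof -
  have sub: "(\<Sum>i\<in>J. g i) \<in> V" if "J \<subseteq> I" for J
    using assms(2) that by (intro subspace_sum banach_on_props(1)[OF V]) auto
  then show "(\<Sum>i\<in>I. g i) \<in> V" by simp
  have "N (\<Sum>i\<in>J. g i) \<le> (\<Sum>i\<in>J. N (g i))" if "finite J" "J \<subseteq> I" for J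
    using that
  proof (induction J)
    case (insert i J)
    then show ?case
      using banach_on_props(5)[OF V, of "g i" "\<Sum>i\<in>J. g i"] assms(2)[of i] sub[of J] by auto
  qed (simp add: banach_on_props(4)[OF V])
  then show "N (\<Sum>i\<in>I. g i) \<le> (\<Sum>i\<in>I. N (g i))"
    by (cases "finite I") (auto simp: banach_on_props(4)[OF V])
qed

lemma banach_on_diff_triangle:
  assumes V: "banach_on V N" and "x \<in> V" "y \<in> V" "z \<in> V"
  shows "N (x - z) \<le> N (x - y) + N (y - z)"
  using banach_on_props(5)[OF V, of "x - y" "y - z"] subspace_diff[OF banach_on_props(1)[OF V]] assms
  by simp

text \<open>Completeness of \<open>V\<close> yields a limit of the partial sums in \<open>V\<close>;
  as \<open>N\<close> controls the ambient norm, this limit must be the ambient sum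
  \<open>y\<close>. Thus convergence known only in \<open>X 0\<close> is upgraded to convergence in
  a smaller space, with a rate.\<close>

lemma banach_on_sums_geometric:
  assumes V: "banach_on V N" and K: "\<And>x. x \<in> V \<Longrightarrow> norm x \<le> K * N x"
    and d: "\<And>n. d n \<in> V" "\<And>n. N (d n) \<le> c * q ^ n" and q: "0 \<le> q" "q < 1"
    and y: "d sums (y :: 'a::real_normed_vector)"
  shows "y \<in> V" "N (y - (\<Sum>i<n. d i)) \<le> c * q ^ n / (1 - q)"
proof -
  note [simp] = subspace_diff[OF banach_on_props(1)[OF V]]
  interpret Metric_space V "ndist V N" by (rule banach_on_props(7)[OF V])
  define P where "P n = (\<Sum>i<n. d i)" for n
  have P: "P n \<in> V" for n unfolding P_def using d by (intro banach_on_sum_le(1)[OF V]) auto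
  have c: "0 \<le> c" using banach_on_props(2)[OF V d(1)[of 0]] d(2)[of 0] by simp
  have tail: "N (P m - P n) \<le> c * q ^ n / (1 - q)" if "n \<le> m" for m n
  proof -
    have "P m - P n = (\<Sum>i\<in>{n..<m}. d i)"
      using that by (simp add: P_def sum_diff_nat_ivl lessThan_atLeast0)
    also have "N \<dots> \<le> (\<Sum>i\<in>{n..<m}. N (d i))"
      using d by (intro banach_on_sum_le(2)[OF V]) auto
    also have "\<dots> \<le> (\<Sum>i\<in>{n..<m}. c * q ^ i)" using d by (intro sum_mono) auto
    also have "\<dots> = c * ((q ^ n - q ^ m) / (1 - q))"
    proof -
      have "(\<Sum>i\<in>{n..<m}. q ^ i) = (q ^ n - q ^ m) / (1 - q)"
        using that
      proof (induction rule: dec_induct)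
        case (step k)
        have "(\<Sum>i\<in>{n..<Suc k}. q ^ i) = (q ^ n - q ^ k) / (1 - q) + q ^ k"
          using step by simp
        then show ?case using q by (simp add: field_simps)
      qed simp
      then show ?thesis by (simp add: sum_distrib_left[symmetric])
    qed
    also have "\<dots> \<le> c * (q ^ n / (1 - q))"
      using c q by (intro mult_left_mono divide_right_mono) auto
    finally show ?thesis by simp
  qed
  have tail_lim: "(\<lambda>n. c * q ^ n / (1 - q)) \<longlonglongrightarrow> 0"
    using q by (intro tendsto_divide_zero tendsto_mult_right_zero LIMSEQ_power_zero) auto
  have "MCauchy P"
    unfolding MCauchy_def
  proof (intro conjI allI impI)
    show "range P \<subseteq> V" using P by auto
    fix e :: real assume "0 < e"
    then obtain n0 where n0: "\<And>n. n \<ge> n0 \<Longrightarrow> c * q ^ n / (1 - q) < e"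
      using order_tendstoD(2)[OF tail_lim] by (auto simp: eventually_sequentially)
    show "\<exists>n0. \<forall>n n'. n0 \<le> n \<longrightarrow> n0 \<le> n' \<longrightarrow> ndist V N (P n) (P n') < e"
    proof (intro exI[of _ n0] allI impI)
      fix n n' assume "n0 \<le> n" "n0 \<le> n'"
      then show "ndist V N (P n) (P n') < e"
        using tail[of n n'] tail[of n' n] n0[of n] n0[of n'] P banach_on_props(6)[OF V, of "P n" "P n'"]
        by (cases "n \<le> n'") (auto simp: ndist_def)
    qed
  qed
  moreover have "mcomplete" using V by (simp add: banach_on_def)
  ultimately obtain l where "limitin mtopology P l sequentially"
    unfolding mcomplete_def by blast
  then have l: "l \<in> V" and "(\<lambda>n. ndist V N (P n) l) \<longlonglongrightarrow> 0"
    by (auto simp: limitin_metric_dist_null)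
  then have lim: "(\<lambda>n. N (P n - l)) \<longlonglongrightarrow> 0" using P by (simp add: ndist_def)
  have "(\<lambda>n. P n - l) \<longlonglongrightarrow> 0"
  proof (rule Lim_null_comparison)
    show "\<forall>\<^sub>F n in sequentially. norm (P n - l) \<le> K * N (P n - l)" using K P l by simp
    show "(\<lambda>n. K * N (P n - l)) \<longlonglongrightarrow> 0" using lim by (rule tendsto_mult_right_zero)
  qed
  then have "P \<longlonglongrightarrow> l" by (simp add: LIM_zero_iff)
  with y have yl: "y = l" unfolding sums_def P_def by (rule LIMSEQ_unique)
  then show "y \<in> V" using l by simp
  \<comment> \<open>The tail bound for finite m passes to the limit through the triangle inequality,
    with an error \<open>N (P m - l)\<close> that vanishes; continuity of \<open>N\<close> is not
    invoked.\<close>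
  have "N (l - P n) \<le> 0 + c * q ^ n / (1 - q)"
  proof (rule tendsto_lowerbound)
    show "(\<lambda>m. N (P m - l) + c * q ^ n / (1 - q)) \<longlonglongrightarrow> 0 + c * q ^ n / (1 - q)"
      by (intro tendsto_add lim tendsto_const)
    show "\<forall>\<^sub>F m in sequentially. N (l - P n) \<le> N (P m - l) + c * q ^ n / (1 - q)"
      using eventually_ge_at_top[of n]
    proof eventually_elim
      case (elim m)
      then show ?case
        using banach_on_diff_triangle[OF V l P[of m] P[of n]] tail[of n m]
          banach_on_props(6)[OF V l P[of m]] by simp
    qed
  qed simp
  then show "N (y - (\<Sum>i<n. d i)) \<le> c * q ^ n / (1 - q)" by (simp add: yl P_def)
qed

text \<open>Limits along filters admit sandwich arguments. Replacing \<open>ndist\<close> by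
  \<open>N\<close> is legitimate because the filter only sees points of \<open>T\<close>, whose
  images lie in \<open>V\<close>.\<close>

lemma continuous_map_ndist_iff:
  assumes V: "banach_on V N"
  shows "continuous_map (top_of_set T) (Metric_space.mtopology V (ndist V N)) f \<longleftrightarrow>
    (\<forall>x\<in>T. f x \<in> V \<and> ((\<lambda>y. N (f y - f x)) \<longlongrightarrow> 0) (at x within T))"
proof -
  interpret Metric_space V "ndist V N" by (rule banach_on_props(7)[OF V])
  have within: "atin_within euclidean x T = at x within T" for x
    by (auto simp: filter_eq_iff eventually_atin_within eventually_at_topological)
  have "continuous_map (top_of_set T) mtopology f \<longleftrightarrow>
      (\<forall>x\<in>T. f x \<in> V \<and> (\<forall>\<^sub>F y in at x within T. f y \<in> V) \<and>
        ((\<lambda>y. ndist V N (f y) (f x)) \<longlongrightarrow> 0) (at x within T))"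
    by (simp add: continuous_map_atin limitin_metric_dist_null atin_subtopology_within within)
  also have "\<dots> \<longleftrightarrow> (\<forall>x\<in>T. f x \<in> V \<and> ((\<lambda>y. N (f y - f x)) \<longlongrightarrow> 0) (at x within T))"
  proof (intro iffI ballI conjI)
    fix x assume x: "x \<in> T"
    {
      assume *: "\<forall>x\<in>T. f x \<in> V \<and> (\<forall>\<^sub>F y in at x within T. f y \<in> V) \<and>
        ((\<lambda>y. ndist V N (f y) (f x)) \<longlongrightarrow> 0) (at x within T)"
      then show "f x \<in> V" using x by blast
      have "\<forall>\<^sub>F y in at x within T. ndist V N (f y) (f x) = N (f y - f x)"
        using * x by (auto simp: eventually_at_filter ndist_def)
      then show "((\<lambda>y. N (f y - f x)) \<longlongrightarrow> 0) (at x within T)"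
        using * x by (auto intro: Lim_transform_eventually)
    next
      assume *: "\<forall>x\<in>T. f x \<in> V \<and> ((\<lambda>y. N (f y - f x)) \<longlongrightarrow> 0) (at x within T)"
      then show "f x \<in> V" using x by blast
      show "\<forall>\<^sub>F y in at x within T. f y \<in> V"
        using * by (auto simp: eventually_at_filter)
      have "\<forall>\<^sub>F y in at x within T. N (f y - f x) = ndist V N (f y) (f x)"
        using * x by (auto simp: eventually_at_filter ndist_def)
      then show "((\<lambda>y. ndist V N (f y) (f x)) \<longlongrightarrow> 0) (at x within T)"
        using * x by (auto intro: Lim_transform_eventually)
    }
  qed
  finally show ?thesis .
qed

text \<open>The supremum controls only triples r < s < t; degenerate triples are covered by the
  vanishing of \<open>f\<close>. The midpoint of [a, b] supplies one genuine triple, hence the sign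
  of the norm.\<close>

lemma holder3D:
  assumes V: "banach_on V N" and ab: "a < b" and f: "f \<in> holder3 V N \<mu> a b"
  shows "0 \<le> holder_norm3 N \<mu> a b f"
    "\<And>r s t. a \<le> r \<Longrightarrow> r \<le> s \<Longrightarrow> s \<le> t \<Longrightarrow> t \<le> b \<Longrightarrow>
      f (r, s, t) \<in> V \<and> N (f (r, s, t)) \<le> holder_norm3 N \<mu> a b f * (t - r) powr \<mu>"
    "\<And>r s. a \<le> r \<Longrightarrow> r \<le> s \<Longrightarrow> s \<le> b \<Longrightarrow> f (r, s, s) = 0"
proof -
  let ?Q = "quotients3 N \<mu> a b f" and ?F = "holder_norm3 N \<mu> a b f"
  have bdd: "bdd_above ?Q" and deg: "\<And>r s t. (r, s, t) \<in> simplex3 a b \<Longrightarrow> r = s \<or> s = t \<Longrightarrow> f (r, s, t) = 0"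
    and cont: "continuous_map (top_of_set (simplex3 a b)) (Metric_space.mtopology V (ndist V N)) f"
    using f by (auto simp: holder3_def)
  have mem: "f (r, s, t) \<in> V" if "a \<le> r" "r \<le> s" "s \<le> t" "t \<le> b" for r s t
    using cont that unfolding continuous_map_ndist_iff[OF V] by (auto simp: simplex3_def)
  have upper: "N (f (r, s, t)) * (t - r) powr - \<mu> \<le> ?F" if "a \<le> r" "r < s" "s < t" "t \<le> b" for r s t
    unfolding holder_norm3_def using that by (intro cSup_upper bdd) (auto simp: quotients3_def)
  have "0 \<le> N (f (a, (a + b) / 2, b)) * (b - a) powr - \<mu>"
    using ab by (intro mult_nonneg_nonneg banach_on_props(2)[OF V] mem) auto
  also have "\<dots> \<le> ?F" using ab by (intro upper) auto
  finally show F: "0 \<le> ?F" .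
  show "f (r, s, s) = 0" if "a \<le> r" "r \<le> s" "s \<le> b" for r s
    using deg[of r s s] that by (simp add: simplex3_def)
  show "f (r, s, t) \<in> V \<and> N (f (r, s, t)) \<le> ?F * (t - r) powr \<mu>"
    if "a \<le> r" "r \<le> s" "s \<le> t" "t \<le> b" for r s t
  proof (cases "r < s \<and> s < t")
    case True
    then show ?thesis
      using upper[of r s t] mem that by (auto simp: powr_minus divide_simps)
  next
    case False
    then have "f (r, s, t) = 0" using deg[of r s t] that by (auto simp: simplex3_def)
    then show ?thesis using F mem[OF that] banach_on_props(4)[OF V] by simp
  qed
qed

lemma holder_norm2_le:
  assumes "a < b" "\<And>s t. a \<le> s \<Longrightarrow> s < t \<Longrightarrow> t \<le> b \<Longrightarrow> N' (M (s, t)) \<le> B * (t - s) powr \<beta>"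
  shows "bdd_above (quotients2 N' \<beta> a b M)" "holder_norm2 N' \<beta> a b M \<le> B"
proof -
  have le: "q \<le> B" if q: "q \<in> quotients2 N' \<beta> a b M" for q
  proof -
    obtain s t where st: "q = N' (M (s, t)) * (t - s) powr - \<beta>" "a \<le> s" "s < t" "t \<le> b"
      using q by (auto simp: quotients2_def)
    have "q \<le> B * (t - s) powr \<beta> * (t - s) powr - \<beta>"
      unfolding st(1) using assms(2) st by (intro mult_right_mono) auto
    also have "\<dots> = B" using st by (simp add: powr_minus)
    finally show ?thesis .
  qed
  then show "bdd_above (quotients2 N' \<beta> a b M)" by (rule bdd_aboveI)
  have "quotients2 N' \<beta> a b M \<noteq> {}" using \<open>a < b\<close> by (auto simp: quotients2_def)
  then show "holder_norm2 N' \<beta> a b M \<le> B" unfolding holder_norm2_def using le by (rule cSup_least)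
qed

subsection \<open>Riemann sums twisted by the semigroup\<close>

context smoothing_semigroup
begin

lemma S_linear [simp]:
  assumes "0 \<le> t"
  shows "S t (x + y) = S t x + S t y" "S t (x - y) = S t x - S t y"
    "S t (- x) = - S t x" "S t 0 = 0" "S t (\<Sum>i\<in>I. g i) = (\<Sum>i\<in>I. S t (g i))"
proof -
  interpret bounded_linear "S t" using S_bounded_linear assms .
  show "S t (x + y) = S t x + S t y" "S t (x - y) = S t x - S t y"
    "S t (- x) = - S t x" "S t 0 = 0" "S t (\<Sum>i\<in>I. g i) = (\<Sum>i\<in>I. S t (g i))"
    by (rule add diff neg zero sum)+
qed

lemma S_compose: "r \<le> s \<Longrightarrow> s \<le> t \<Longrightarrow> S (t - s) (S (s - r) x) = S (t - r) x"
  using S_add[of "s - r" "t - s" x] by simp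

text \<open>This is the smoothing bound without gain of regularity. It requires a positive horizon,
  whence \<open>max T 1\<close>, and omits t = 0, whence \<open>max L 1\<close>.\<close>

lemma S_bounded_on:
  obtains L where "0 < L" "\<And>t x. 0 \<le> t \<Longrightarrow> t \<le> T \<Longrightarrow> norm (S t x) \<le> L * norm x"
proof -
  have "0 < max T 1" by simp
  then obtain L where L: "0 < L"
    "\<forall>t\<in>{0<..max T 1}. op_bound (X 0) (N 0) (X 0) (N 0) (S t) (L * t powr (- 0 + 0))"
    using S_smoothing[of "max T 1" 0 0] by auto
  have "norm (S t x) \<le> max L 1 * norm x" if "0 \<le> t" "t \<le> T" for t x
  proof (cases "t = 0")
    case True
    then show ?thesis using S_zero mult_right_mono[of 1 "max L 1" "norm x"] by simp
  next
    case False
    then have "norm (S t x) \<le> L * norm x"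
      using L(2) that by (auto simp: op_bound_def X_0)
    also have "\<dots> \<le> max L 1 * norm x" by (intro mult_right_mono) auto
    finally show ?thesis .
  qed
  then show ?thesis using that[of "max L 1"] by simp
qed

lemma norm_le_N:
  assumes "0 \<le> \<gamma>" "\<gamma> < 3"
  obtains K where "0 < K" "\<And>x. x \<in> X \<gamma> \<Longrightarrow> norm x \<le> K * N \<gamma> x"
proof (cases "\<gamma> = 0")
  case True
  then show ?thesis using that[of 1] X_0 by simp
next
  case False
  then show ?thesis using X_embed[of 0 \<gamma>] assms that by (auto simp: op_bound_def X_0)
qed

definition solves :: "real \<Rightarrow> real \<Rightarrow> (real \<times> real \<times> real \<Rightarrow> 'a) \<Rightarrow> (real \<times> real \<Rightarrow> 'a) \<Rightarrow> bool" where
  "solves a b f M \<longleftrightarrow> (\<forall>p\<in>simplex3 a b. delta_hat2 S M p = S_op3 S f p)"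

lemma solvesD:
  assumes "solves a b f M" "a \<le> r" "r \<le> s" "s \<le> t" "t \<le> b"
  shows "M (r, t) = M (s, t) + S (t - s) (M (r, s)) + S (t - s) (f (r, s, t))"
proof -
  have "(r, s, t) \<in> simplex3 a b" using assms by (simp add: simplex3_def)
  then have "delta_hat2 S M (r, s, t) = S_op3 S f (r, s, t)"
    using assms(1) unfolding solves_def by blast
  then show ?thesis by (simp add: delta_hat2_def S_op3_def algebra_simps)
qed

definition riemann_sum :: "(real \<times> real \<Rightarrow> 'a) \<Rightarrow> real \<Rightarrow> (nat \<Rightarrow> real) \<Rightarrow> nat \<Rightarrow> 'a" where
  "riemann_sum H t p m = (\<Sum>k<m. S (t - p (Suc k)) (H (p k, p (Suc k))))"

text \<open>Here \<open>p\<close> is the fine partition: even indices are the coarse points, odd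
  indices the inserted ones, and \<open>m\<close> counts coarse intervals.\<close>

definition refinement_sum :: "(real \<times> real \<times> real \<Rightarrow> 'a) \<Rightarrow> real \<Rightarrow> (nat \<Rightarrow> real) \<Rightarrow> nat \<Rightarrow> 'a" where
  "refinement_sum f t p m =
     (\<Sum>k<m. S (t - p (2 * k + 1)) (f (p (2 * k), p (2 * k + 1), p (2 * k + 2))))"

text \<open>Splitting \<open>H\<close> over a coarse interval at its inserted point leaves one term
  in \<open>f\<close>, and the semigroup law merges the two transports, first to the right end and
  then to t.\<close>

lemma riemann_sum_refine:
  assumes H: "solves a b f H" and p: "mono p" "a \<le> p 0" "p (2 * m) \<le> t" "t \<le> b"
  shows "riemann_sum H t (\<lambda>k. p (2 * k)) m - riemann_sum H t p (2 * m) = refinement_sum f t p m"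
  using p(3)
proof (induction m)
  case 0
  then show ?case by (simp add: riemann_sum_def refinement_sum_def)
next
  case (Suc m)
  let ?u = "p (2 * m)" and ?v = "p (2 * m + 1)" and ?w = "p (2 * m + 2)"
  have ord: "p 0 \<le> ?u" "?u \<le> ?v" "?v \<le> ?w" "?w \<le> t"
    using Suc.prems by (auto intro: monoD[OF p(1)])
  have "S (t - ?w) (H (?u, ?w)) =
      S (t - ?w) (H (?v, ?w)) + S (t - ?v) (H (?u, ?v)) + S (t - ?v) (f (?u, ?v, ?w))"
    using solvesD[OF H, of ?u ?v ?w] ord p by (simp add: S_compose)
  moreover have "riemann_sum H t (\<lambda>k. p (2 * k)) m - riemann_sum H t p (2 * m) = refinement_sum f t p m"
    using Suc.IH ord by simp
  ultimately show ?case
    by (simp add: riemann_sum_def refinement_sum_def algebra_simps)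
qed

lemma norm_refinement_sum_le:
  assumes L: "0 \<le> L" "\<And>u x. 0 \<le> u \<Longrightarrow> u \<le> b - a \<Longrightarrow> norm (S u x) \<le> L * norm x"
    and f: "\<And>r s t. a \<le> r \<Longrightarrow> r \<le> s \<Longrightarrow> s \<le> t \<Longrightarrow> t \<le> b \<Longrightarrow> norm (f (r, s, t)) \<le> F * (t - r) powr \<mu>"
    and F: "0 \<le> F"
    and p: "mono p" "a \<le> p 0" "p (2 * m) \<le> t" "t \<le> b"
    and gap: "\<And>k. k < m \<Longrightarrow> p (2 * k + 2) - p (2 * k) \<le> \<delta>"
    and \<kappa>: "1 \<le> \<kappa>" "\<kappa> \<le> \<mu>"
  shows "norm (refinement_sum f t p m) \<le> L * F * \<delta> powr (\<mu> - \<kappa>) * (p (2 * m) - p 0) powr \<kappa>"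
proof -
  have "norm (refinement_sum f t p m) \<le> (\<Sum>k<m. L * F * (p (2 * Suc k) - p (2 * k)) powr \<mu>)"
    unfolding refinement_sum_def
  proof (rule sum_norm_le)
    fix k assume "k \<in> {..<m}"
    then have k: "p (2 * k + 2) \<le> p (2 * m)" "p 0 \<le> p (2 * k)" "p (2 * k) \<le> p (2 * k + 1)"
      "p (2 * k + 1) \<le> p (2 * k + 2)"
      by (auto intro!: monoD[OF p(1)])
    have "norm (S (t - p (2 * k + 1)) (f (p (2 * k), p (2 * k + 1), p (2 * k + 2))))
        \<le> L * norm (f (p (2 * k), p (2 * k + 1), p (2 * k + 2)))"
      using k p by (intro L) auto
    also have "\<dots> \<le> L * (F * (p (2 * k + 2) - p (2 * k)) powr \<mu>)"
      using k p by (intro mult_left_mono f L) auto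
    finally show "norm (S (t - p (2 * k + 1)) (f (p (2 * k), p (2 * k + 1), p (2 * k + 2))))
        \<le> L * F * (p (2 * Suc k) - p (2 * k)) powr \<mu>"
      by (simp add: mult.assoc)
  qed
  also have "\<dots> = L * F * (\<Sum>k<m. (p (2 * Suc k) - p (2 * k)) powr \<mu>)"
    by (simp add: sum_distrib_left)
  also have "\<dots> \<le> L * F * (\<delta> powr (\<mu> - \<kappa>) * (p (2 * m) - p (2 * 0)) powr \<kappa>)"
    using gap \<kappa> L F by (intro mult_left_mono sum_gaps_powr_le) (auto intro!: monoI monoD[OF p(1)])
  finally show ?thesis by (simp add: mult.assoc)
qed

text \<open>The partition of \<open>[s, t]\<close> cut out by the dyadic partition of \<open>[a, b]\<close>. Clamping, instead of
  intersecting, keeps the index set and only adds degenerate intervals, on which all increments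
  vanish.\<close>

definition clamped :: "real \<Rightarrow> real \<Rightarrow> real \<Rightarrow> real \<Rightarrow> nat \<Rightarrow> nat \<Rightarrow> real" where
  "clamped a b s t n k = max s (min t (a + (b - a) * (real k / 2 ^ n)))"

lemma clamped_props:
  assumes "a \<le> s" "s \<le> t" "t \<le> b"
  shows "clamped a b s t n 0 = s" "clamped a b s t n (2 ^ n) = t" "mono (clamped a b s t n)"
    "clamped a b s t (Suc n) (2 * k) = clamped a b s t n k"
    "clamped a b s t n (Suc k) - clamped a b s t n k \<le> (b - a) / 2 ^ n"
    "s \<le> clamped a b s t n k" "clamped a b s t n k \<le> t"
proof -
  have ab: "0 \<le> b - a" using assms by simp
  show "clamped a b s t n 0 = s" "clamped a b s t n (2 ^ n) = t"
    "s \<le> clamped a b s t n k" "clamped a b s t n k \<le> t"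
    "clamped a b s t (Suc n) (2 * k) = clamped a b s t n k"
    using assms by (auto simp: clamped_def)
  show "mono (clamped a b s t n)"
  proof (rule monoI)
    fix i j :: nat assume "i \<le> j"
    then have "(b - a) * (real i / 2 ^ n) \<le> (b - a) * (real j / 2 ^ n)"
      using ab by (intro mult_left_mono divide_right_mono) auto
    then show "clamped a b s t n i \<le> clamped a b s t n j" by (auto simp: clamped_def)
  qed
  have "(b - a) * (real (Suc k) / 2 ^ n) = (b - a) * (real k / 2 ^ n) + (b - a) / 2 ^ n"
    by (simp add: field_simps)
  moreover have "0 \<le> (b - a) / 2 ^ n" using ab by simp
  ultimately show "clamped a b s t n (Suc k) - clamped a b s t n k \<le> (b - a) / 2 ^ n"
    unfolding clamped_def by linarith
qed

text \<open>The three partitions come from the same dyadic points. An interval on one side of s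
  contributes equally to both sides of the additivity relation; one with s in its interior leaves
  \<open>S (t - s) (f (u, s, v))\<close>. Summing the bounds with \<kappa> = 1 gives a defect that
  vanishes with the mesh.\<close>

lemma clamped_additive_defect:
  assumes H: "solves a b f H" and H0: "\<And>u. H (u, u) = 0"
    and f: "\<And>r s t. a \<le> r \<Longrightarrow> r \<le> s \<Longrightarrow> s \<le> t \<Longrightarrow> t \<le> b \<Longrightarrow> norm (f (r, s, t)) \<le> F * (t - r) powr \<mu>"
    and F: "0 \<le> F"
    and L: "0 \<le> L" "\<And>u x. 0 \<le> u \<Longrightarrow> u \<le> b - a \<Longrightarrow> norm (S u x) \<le> L * norm x"
    and \<mu>: "1 \<le> \<mu>" and rst: "a \<le> r" "r \<le> s" "s \<le> t" "t \<le> b"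
  shows "norm (riemann_sum H t (clamped a b r t n) (2 ^ n) - riemann_sum H t (clamped a b s t n) (2 ^ n)
      - S (t - s) (riemann_sum H s (clamped a b r s n) (2 ^ n)))
    \<le> L * F * ((b - a) / 2 ^ n) powr (\<mu> - 1) * (t - r)"
proof -
  let ?p = "clamped a b r t n" and ?q = "clamped a b s t n" and ?o = "clamped a b r s n"
  have p: "?p 0 = r" "?p (2 ^ n) = t" "mono ?p" "\<And>k. ?p (Suc k) - ?p k \<le> (b - a) / 2 ^ n"
    "\<And>k. r \<le> ?p k" "\<And>k. ?p k \<le> t"
    using clamped_props[of a r t b n] rst by simp_all
  \<comment> \<open>Both sub-partitions are expressed through that of [r, t], so that a single case
    distinction on the position of s suffices.\<close>
  have qo: "?q k = max s (?p k)" "?o k = min s (?p k)" for k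
    using rst by (auto simp: clamped_def)
  have bound: "norm (S (t - ?p (Suc k)) (H (?p k, ?p (Suc k))) - S (t - ?q (Suc k)) (H (?q k, ?q (Suc k)))
      - S (t - s) (S (s - ?o (Suc k)) (H (?o k, ?o (Suc k)))))
    \<le> L * F * (?p (Suc k) - ?p k) powr \<mu>" (is "norm ?lhs \<le> _") for k
  proof -
    let ?u = "?p k" and ?v = "?p (Suc k)"
    have uv: "?u \<le> ?v" "r \<le> ?u" "?v \<le> t" using p by (auto simp: monoD)
    consider "?v \<le> s" | "s \<le> ?u" | "?u < s" "s < ?v" by linarith
    then show ?thesis
    proof cases
      case 1
      then have "?lhs = 0" using uv rst H0 by (simp add: qo max_def min_def S_compose)
      then show ?thesis using L F by simp
    next
      case 2
      then have "?lhs = 0" using uv rst H0 by (simp add: qo max_def min_def S_compose)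
      then show ?thesis using L F by simp
    next
      case 3
      have "H (?u, ?v) = H (s, ?v) + S (?v - s) (H (?u, s)) + S (?v - s) (f (?u, s, ?v))"
        using solvesD[OF H, of ?u s ?v] uv rst 3 by simp
      then have "?lhs = S (t - s) (f (?u, s, ?v))"
        using uv rst 3 by (simp add: qo max_def min_def S_compose S_zero)
      moreover have "norm (S (t - s) (f (?u, s, ?v))) \<le> L * norm (f (?u, s, ?v))"
        using rst by (intro L) auto
      moreover have "L * norm (f (?u, s, ?v)) \<le> L * (F * (?v - ?u) powr \<mu>)"
        using uv rst 3 L by (intro mult_left_mono f) auto
      ultimately show ?thesis by (simp add: mult.assoc)
    qed
  qed
  have "norm (\<Sum>k<2^n. S (t - ?p (Suc k)) (H (?p k, ?p (Suc k))) - S (t - ?q (Suc k)) (H (?q k, ?q (Suc k)))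
      - S (t - s) (S (s - ?o (Suc k)) (H (?o k, ?o (Suc k))))) \<le> (\<Sum>k<2^n. L * F * (?p (Suc k) - ?p k) powr \<mu>)"
    by (intro sum_norm_le bound)
  also have "\<dots> = L * F * (\<Sum>k<2^n. (?p (Suc k) - ?p k) powr \<mu>)"
    by (simp add: sum_distrib_left)
  also have "\<dots> \<le> L * F * (((b - a) / 2 ^ n) powr (\<mu> - 1) * (?p (2 ^ n) - ?p 0) powr 1)"
    using p \<mu> L F by (intro mult_left_mono sum_gaps_powr_le) auto
  finally show ?thesis
    using rst p by (simp add: riemann_sum_def sum_subtractf mult.assoc)
qed

text \<open>Only the ambient norm and some exponent above 1 are obtained, which is exactly what
  \<open>sums_dyadic_level\<close> asks for; the sharp exponents are recovered afterwards from the
  dyadic expansion.\<close>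

lemma sewing_exists:
  assumes ab: "a < b" and \<mu>: "1 < \<mu>"
    and f: "\<And>r s t. a \<le> r \<Longrightarrow> r \<le> s \<Longrightarrow> s \<le> t \<Longrightarrow> t \<le> b \<Longrightarrow> norm (f (r, s, t)) \<le> F * (t - r) powr \<mu>"
    and F: "0 \<le> F"
    and f0: "\<And>r s. a \<le> r \<Longrightarrow> r \<le> s \<Longrightarrow> s \<le> b \<Longrightarrow> f (r, s, s) = 0"
    and cocycle: "\<forall>p\<in>simplex4 a b. delta_S3 S f p = 0"
  obtains M C \<kappa> where "solves a b f M" "1 < \<kappa>" "0 \<le> C"
    "\<And>s t. a \<le> s \<Longrightarrow> s \<le> t \<Longrightarrow> t \<le> b \<Longrightarrow> norm (M (s, t)) \<le> C * (t - s) powr \<kappa>"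
proof -
  obtain L where L: "0 < L" "\<And>u x. 0 \<le> u \<Longrightarrow> u \<le> b - a \<Longrightarrow> norm (S u x) \<le> L * norm x"
    using S_bounded_on[of "b - a"] by metis
  \<comment> \<open>The value 0 off the simplex makes \<open>h (u, u) = 0\<close> true for every
    real u, as \<open>clamped_additive_defect\<close> demands.\<close>
  define h where "h = (\<lambda>(s, t). if a \<le> s \<and> s \<le> t \<and> t \<le> b then - S (t - s) (f (a, s, t)) else 0)"
  have h_diag: "h (u, u) = 0" for u
    using f0[of a u] by (simp add: h_def)
  have h: "solves a b f h"
    unfolding solves_def
  proof
    fix p assume "p \<in> simplex3 a b"
    then obtain r s t where p: "p = (r, s, t)" and rst: "a \<le> r" "r \<le> s" "s \<le> t" "t \<le> b"
      by (auto simp: simplex3_def)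
    \<comment> \<open>The cocycle identity is used with first vertex a; applying
      \<open>S (t - s)\<close> to it turns its terms into the values of \<open>h\<close>.\<close>
    have "(a, r, s, t) \<in> simplex4 a b" using rst by (simp add: simplex4_def)
    then have "f (r, s, t) - f (a, s, t) + S (s - r) (f (a, r, t) - f (a, r, s)) = 0"
      using cocycle by (force simp: delta_S3_def)
    then have "S (t - s) (f (r, s, t) - f (a, s, t) + S (s - r) (f (a, r, t) - f (a, r, s))) = 0"
      using rst by simp
    then have "S (t - s) (f (r, s, t)) - S (t - s) (f (a, s, t)) + S (t - r) (f (a, r, t)) - S (t - r) (f (a, r, s)) = 0"
      using rst by (simp add: S_compose algebra_simps)
    then show "delta_hat2 S h p = S_op3 S f p"
      using rst by (simp add: p delta_hat2_def S_op3_def h_def S_compose algebra_simps)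
  qed
  \<comment> \<open>The midpoint of 1 and \<mu> leaves room on both sides: \<kappa> > 1 for the
    final bound, \<mu> - \<kappa> > 0 for geometric decay of the levels.\<close>
  define \<kappa> where "\<kappa> = (1 + \<mu>) / 2"
  have \<kappa>: "1 < \<kappa>" "\<kappa> < \<mu>" using \<mu> by (simp_all add: \<kappa>_def field_simps)
  define J where "J n s t = riemann_sum h t (clamped a b s t n) (2 ^ n)" for n s t
  define R where "R n s t = refinement_sum f t (clamped a b s t (Suc n)) (2 ^ n)" for n s t
  define \<rho> where "\<rho> = (1/2::real) powr (\<mu> - \<kappa>)"
  define c where "c = L * F * (b - a) powr (\<mu> - \<kappa>)"
  have \<rho>: "0 \<le> \<rho>" "\<rho> < 1" using \<kappa> half_powr_less_1 by (simp_all add: \<rho>_def)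
  have c: "0 \<le> c" using L F by (simp add: c_def)
  have JR: "J n s t - J (Suc n) s t = R n s t" if "a \<le> s" "s \<le> t" "t \<le> b" for n s t
    using riemann_sum_refine[OF h, of "clamped a b s t (Suc n)" "2 ^ n" t] that
      clamped_props[OF that, of "Suc n"] clamped_props(4)[OF that, of n]
    by (simp add: J_def R_def)
  have R: "norm (R n s t) \<le> c * (t - s) powr \<kappa> * \<rho> ^ n" if st: "a \<le> s" "s \<le> t" "t \<le> b" for n s t
  proof -
    have "norm (R n s t) \<le> L * F * ((b - a) / 2 ^ n) powr (\<mu> - \<kappa>) *
        (clamped a b s t (Suc n) (2 * 2 ^ n) - clamped a b s t (Suc n) 0) powr \<kappa>"
      unfolding R_def
    proof (rule norm_refinement_sum_le[where a = a and b = b])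
      show "clamped a b s t (Suc n) (2 * k + 2) - clamped a b s t (Suc n) (2 * k) \<le> (b - a) / 2 ^ n" for k
        using clamped_props(4)[OF st, of n "Suc k"] clamped_props(4,5)[OF st, of n k] by simp
    qed (use L F f \<kappa> st clamped_props[OF st, of "Suc n"] in auto)
    also have "\<dots> = c * (t - s) powr \<kappa> * \<rho> ^ n"
      using clamped_props(1,2)[OF st, of "Suc n"] ab by (simp add: c_def \<rho>_def powr_dyadic)
    finally show ?thesis .
  qed
  have geo: "summable (\<lambda>n. c * (t - s) powr \<kappa> * \<rho> ^ n)" for s t
    using \<rho> by (intro summable_mult summable_geometric) auto
  have R_sum: "summable (\<lambda>n. norm (R n s t))" if "a \<le> s" "s \<le> t" "t \<le> b" for s t
    using R[OF that] by (intro summable_comparison_test'[OF geo]) auto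
  \<comment> \<open>Since the \<open>R n\<close> are the successive differences of the Riemann sums
    starting at \<open>h\<close>, their sum is \<open>h\<close> minus the limit of these
    sums.\<close>
  define M where "M = (\<lambda>(s, t). \<Sum>n. R n s t)"
  have J0: "J 0 s t = h (s, t)" if "a \<le> s" "s \<le> t" "t \<le> b" for s t
    using clamped_props(1,2)[OF that, of 0] by (simp add: J_def riemann_sum_def S_zero)
  have J_lim: "(\<lambda>n. J n s t) \<longlonglongrightarrow> h (s, t) - M (s, t)" if st: "a \<le> s" "s \<le> t" "t \<le> b" for s t
  proof -
    have "(\<Sum>i<n. R i s t) = h (s, t) - J n s t" for n
      using sum_lessThan_telescope'[of "\<lambda>n. J n s t" n] JR[OF st] J0[OF st] by simp
    moreover have "(\<lambda>n. \<Sum>i<n. R i s t) \<longlonglongrightarrow> M (s, t)"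
      using summable_LIMSEQ[OF summable_norm_cancel[OF R_sum[OF st]]] by (simp add: M_def)
    ultimately have "(\<lambda>n. h (s, t) - (h (s, t) - J n s t)) \<longlonglongrightarrow> h (s, t) - M (s, t)"
      by (intro tendsto_diff) auto
    then show ?thesis by simp
  qed
  have "solves a b f M"
    unfolding solves_def
  proof
    fix p assume "p \<in> simplex3 a b"
    then obtain r s t where p: "p = (r, s, t)" and rst: "a \<le> r" "r \<le> s" "s \<le> t" "t \<le> b"
      by (auto simp: simplex3_def)
    interpret St: bounded_linear "S (t - s)" using S_bounded_linear rst by simp
    let ?E = "\<lambda>n. J n r t - J n s t - S (t - s) (J n r s)"
    have "?E \<longlonglongrightarrow> (h (r, t) - M (r, t)) - (h (s, t) - M (s, t)) - S (t - s) (h (r, s) - M (r, s))"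
      using rst by (intro tendsto_diff St.tendsto J_lim) auto
    \<comment> \<open>The limit \<open>h - M\<close> of the Riemann sums is therefore additive up to
      transport by \<open>S\<close>, so \<open>M\<close> inherits the equation of
      \<open>h\<close>.\<close>
    moreover have "?E \<longlonglongrightarrow> 0"
    proof (rule Lim_null_comparison)
      show "\<forall>\<^sub>F n in sequentially. norm (?E n) \<le>
          L * F * (b - a) powr (\<mu> - 1) * (t - r) * ((1/2) powr (\<mu> - 1)) ^ n"
        unfolding J_def using clamped_additive_defect[OF h h_diag f F _ L(2) _ rst] L \<mu> ab
        by (intro always_eventually allI) (simp add: powr_dyadic mult.assoc mult.commute mult.left_commute)
      show "(\<lambda>n. L * F * (b - a) powr (\<mu> - 1) * (t - r) * ((1/2) powr (\<mu> - 1)) ^ n) \<longlonglongrightarrow> 0"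
        using \<mu> half_powr_less_1[of "\<mu> - 1"] by (intro tendsto_mult_right_zero LIMSEQ_power_zero) simp
    qed
    ultimately have "(h (r, t) - M (r, t)) - (h (s, t) - M (s, t)) - S (t - s) (h (r, s) - M (r, s)) = 0"
      by (rule LIMSEQ_unique)
    then have "M (r, t) - M (s, t) - S (t - s) (M (r, s)) = h (r, t) - h (s, t) - S (t - s) (h (r, s))"
      using rst by (simp add: algebra_simps)
    also have "\<dots> = S (t - s) (f (r, s, t))"
      using solvesD[OF h rst] by simp
    finally show "delta_hat2 S M p = S_op3 S f p"
      by (simp add: p delta_hat2_def S_op3_def)
  qed
  moreover have "norm (M (s, t)) \<le> c / (1 - \<rho>) * (t - s) powr \<kappa>" if st: "a \<le> s" "s \<le> t" "t \<le> b" for s t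
  proof -
    have "norm (M (s, t)) \<le> (\<Sum>n. norm (R n s t))"
      unfolding M_def using summable_norm[OF R_sum[OF st]] by simp
    also have "\<dots> \<le> (\<Sum>n. c * (t - s) powr \<kappa> * \<rho> ^ n)"
      by (intro suminf_le R R_sum geo st)
    also have "\<dots> = c / (1 - \<rho>) * (t - s) powr \<kappa>"
      using \<rho> by (simp add: suminf_mult suminf_geometric)
    finally show ?thesis .
  qed
  ultimately show ?thesis using that[of M \<kappa> "c / (1 - \<rho>)"] \<kappa> c \<rho> by simp
qed

section \<open>Expansion of a solution along the dyadic partitions of [s, t]\<close>

definition dyadic :: "real \<Rightarrow> real \<Rightarrow> nat \<Rightarrow> nat \<Rightarrow> real" where
  "dyadic s t n k = s + (t - s) * (real k / 2 ^ n)"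

lemma dyadic_props:
  assumes "s \<le> t"
  shows "dyadic s t n 0 = s" "dyadic s t n (2 ^ n) = t" "mono (dyadic s t n)"
    "dyadic s t (Suc n) (2 * k) = dyadic s t n k"
    "dyadic s t n (Suc k) - dyadic s t n k = (t - s) / 2 ^ n"
proof -
  show "dyadic s t n 0 = s" "dyadic s t n (2 ^ n) = t"
    "dyadic s t (Suc n) (2 * k) = dyadic s t n k"
    "dyadic s t n (Suc k) - dyadic s t n k = (t - s) / 2 ^ n"
    by (simp_all add: dyadic_def field_simps)
  show "mono (dyadic s t n)"
    unfolding dyadic_def using assms
    by (intro monoI add_left_mono mult_left_mono divide_right_mono) auto
qed

text \<open>Level n compares 2^n with 2^(n+1) intervals, hence the partition of index
  \<open>Suc n\<close> with 2^n coarse intervals. Unlike clamped points, the inserted points stay at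
  distance at least (t - s) / 2^(n+1) from t.\<close>

definition dyadic_level :: "(real \<times> real \<times> real \<Rightarrow> 'a) \<Rightarrow> nat \<Rightarrow> real \<times> real \<Rightarrow> 'a" where
  "dyadic_level f n = (\<lambda>(s, t). refinement_sum f t (dyadic s t (Suc n)) (2 ^ n))"

text \<open>The levels telescope from the one-interval sum, which is \<open>M (s, t)\<close>. The
  series involves \<open>f\<close> alone, so every solution with such a bound has the same
  values.\<close>

lemma sums_dyadic_level:
  assumes M: "solves a b f M" and \<kappa>: "1 < \<kappa>" and C: "0 \<le> C"
    and M_le: "\<And>s t. a \<le> s \<Longrightarrow> s \<le> t \<Longrightarrow> t \<le> b \<Longrightarrow> norm (M (s, t)) \<le> C * (t - s) powr \<kappa>"
    and st: "a \<le> s" "s \<le> t" "t \<le> b"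
  shows "(\<lambda>n. dyadic_level f n (s, t)) sums M (s, t)"
proof -
  obtain L where L: "0 < L" "\<And>u x. 0 \<le> u \<Longrightarrow> u \<le> b - a \<Longrightarrow> norm (S u x) \<le> L * norm x"
    using S_bounded_on[of "b - a"] by metis
  let ?J = "\<lambda>n. riemann_sum M t (dyadic s t n) (2 ^ n)"
  have level: "?J n - ?J (Suc n) = dyadic_level f n (s, t)" for n
    using riemann_sum_refine[OF M, of "dyadic s t (Suc n)" "2 ^ n" t] st
      dyadic_props[OF st(2), of "Suc n"] dyadic_props(4)[OF st(2), of n]
    by (simp add: dyadic_level_def)
  have J0: "?J 0 = M (s, t)"
    using dyadic_props(1,2)[OF st(2), of 0] by (simp add: riemann_sum_def S_zero)
  \<comment> \<open>There are 2^n terms of order 2^(-n \<kappa>), and \<kappa> > 1.\<close>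
  have "(\<lambda>n. ?J n) \<longlonglongrightarrow> 0"
  proof (rule Lim_null_comparison)
    show "\<forall>\<^sub>F n in sequentially. norm (?J n) \<le>
        L * C * (t - s) powr (\<kappa> - 1) * (t - s) * ((1/2) powr (\<kappa> - 1)) ^ n"
    proof (intro always_eventually allI)
      fix n
      let ?p = "dyadic s t n"
      have p: "?p 0 = s" "?p (2 ^ n) = t" "mono ?p" "\<And>k. ?p (Suc k) - ?p k = (t - s) / 2 ^ n"
        using dyadic_props[OF st(2), of n] by simp_all
      have "norm (?J n) \<le> (\<Sum>k<2^n. L * C * (?p (Suc k) - ?p k) powr \<kappa>)"
        unfolding riemann_sum_def
      proof (rule sum_norm_le)
        fix k :: nat assume "k \<in> {..<2^n}"
        then have "?p 0 \<le> ?p k" "?p k \<le> ?p (Suc k)" "?p (Suc k) \<le> ?p (2 ^ n)"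
          by (auto intro!: monoD[OF p(3)])
        then have k: "s \<le> ?p k" "?p k \<le> ?p (Suc k)" "?p (Suc k) \<le> t" using p by simp_all
        have "norm (S (t - ?p (Suc k)) (M (?p k, ?p (Suc k)))) \<le> L * norm (M (?p k, ?p (Suc k)))"
          using k st by (intro L) auto
        also have "\<dots> \<le> L * (C * (?p (Suc k) - ?p k) powr \<kappa>)"
          using k st L by (intro mult_left_mono M_le) auto
        finally show "norm (S (t - ?p (Suc k)) (M (?p k, ?p (Suc k)))) \<le> L * C * (?p (Suc k) - ?p k) powr \<kappa>"
          by (simp add: mult.assoc)
      qed
      also have "\<dots> = L * C * (\<Sum>k<2^n. (?p (Suc k) - ?p k) powr \<kappa>)"
        by (simp add: sum_distrib_left)
      also have "\<dots> \<le> L * C * (((t - s) / 2 ^ n) powr (\<kappa> - 1) * (?p (2 ^ n) - ?p 0) powr 1)"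
        using p \<kappa> L C by (intro mult_left_mono sum_gaps_powr_le) auto
      finally show "norm (?J n) \<le> L * C * (t - s) powr (\<kappa> - 1) * (t - s) * ((1/2) powr (\<kappa> - 1)) ^ n"
        using st p by (simp add: powr_dyadic mult.assoc mult.commute mult.left_commute)
    qed
    show "(\<lambda>n. L * C * (t - s) powr (\<kappa> - 1) * (t - s) * ((1/2) powr (\<kappa> - 1)) ^ n) \<longlonglongrightarrow> 0"
      using \<kappa> half_powr_less_1[of "\<kappa> - 1"] by (intro tendsto_mult_right_zero LIMSEQ_power_zero) simp
  qed
  then have "(\<lambda>n. ?J 0 - ?J n) \<longlonglongrightarrow> ?J 0 - 0"
    by (intro tendsto_diff tendsto_const)
  moreover have "(\<Sum>i<n. dyadic_level f i (s, t)) = ?J 0 - ?J n" for n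
    using sum_lessThan_telescope'[of ?J n] level by simp
  ultimately show ?thesis unfolding sums_def using J0 by simp
qed

subsection \<open>Regularity of the dyadic expansion\<close>

text \<open>Writing \<open>S \<tau> x - S \<sigma> x = S c (S (\<tau> - \<sigma>) y - y)\<close> with \<open>y = S (\<sigma> - c) x\<close>, the inner semigroup
  provides the regularity that the Hoelder estimate for \<open>S (\<tau> - \<sigma>) - I\<close> from \<open>X 1\<close> to \<open>X 0\<close>
  consumes, and the outer one lifts the result back to \<open>X \<gamma>\<close>.\<close>

lemma S_time_Lipschitz:
  assumes c: "0 < c" "2 * c \<le> T" and \<gamma>: "0 \<le> \<gamma>" "\<gamma> < 3"
  obtains K where "0 \<le> K"
    "\<And>\<sigma> \<tau>. 2 * c \<le> \<sigma> \<Longrightarrow> \<sigma> \<le> T \<Longrightarrow> 2 * c \<le> \<tau> \<Longrightarrow> \<tau> \<le> T \<Longrightarrow> N \<gamma> (S \<tau> x - S \<sigma> x) \<le> K * \<bar>\<tau> - \<sigma>\<bar>"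
proof -
  have T: "0 < T" using c by simp
  obtain L where L: "0 < L" "\<And>t. 0 < t \<Longrightarrow> t \<le> T \<Longrightarrow> op_bound (X 0) (N 0) (X 1) (N 1) (S t) (L * t powr (- 1 + 0))"
    using S_smoothing[of T 0 1] T by auto
  obtain C where C: "0 < C" "\<And>t. 0 < t \<Longrightarrow> t \<le> T \<Longrightarrow>
      op_bound (X 1) (N 1) (X 0) (N 0) (\<lambda>x. S t x - x) (C * t powr (1 - 0))"
    using S_near_id[of T 0 1] T by auto
  obtain L' where L': "0 < L'" "\<And>t. 0 < t \<Longrightarrow> t \<le> T \<Longrightarrow>
      op_bound (X 0) (N 0) (X \<gamma>) (N \<gamma>) (S t) (L' * t powr (- \<gamma> + 0))"
    using S_smoothing[of T 0 \<gamma>] T \<gamma> by auto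
  \<comment> \<open>The factors bound \<open>S c\<close> from \<open>X 0\<close> to
    \<open>X \<gamma>\<close>, the increment from \<open>X 1\<close> to \<open>X 0\<close>, and
    \<open>S (\<sigma> - c)\<close> from \<open>X 0\<close> to \<open>X 1\<close>; the last is
    uniform because \<sigma> \<ge> 2 * c gives \<sigma> - c \<ge> c.\<close>
  define K where "K = L' * c powr (- \<gamma>) * (C * (L * c powr (- 1) * norm x))"
  have V: "banach_on (X \<gamma>) (N \<gamma>)" using X_banach \<gamma> .
  have inc: "N \<gamma> (S \<tau> x - S \<sigma> x) \<le> K * \<bar>\<tau> - \<sigma>\<bar>" if "2 * c \<le> \<sigma>" "\<sigma> < \<tau>" "\<tau> \<le> T" for \<sigma> \<tau>
  proof -
    let ?y = "S (\<sigma> - c) x"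
    have y: "?y \<in> X 1" "N 1 ?y \<le> L * (\<sigma> - c) powr (- 1) * norm x"
      using L(2)[of "\<sigma> - c"] that c by (auto simp: op_bound_def X_0)
    have "L * (\<sigma> - c) powr (- 1) * norm x \<le> L * c powr (- 1) * norm x"
      using that c L by (intro mult_right_mono mult_left_mono powr_mono2') auto
    then have y_le: "N 1 ?y \<le> L * c powr (- 1) * norm x" using y by simp
    have "norm (S (\<tau> - \<sigma>) ?y - ?y) \<le> C * (\<tau> - \<sigma>) * N 1 ?y"
      using C(2)[of "\<tau> - \<sigma>"] y that c by (auto simp: op_bound_def X_0)
    also have "\<dots> \<le> C * (\<tau> - \<sigma>) * (L * c powr (- 1) * norm x)"
      using y_le that C by (intro mult_left_mono) auto
    finally have diff: "norm (S (\<tau> - \<sigma>) ?y - ?y) \<le> C * (\<tau> - \<sigma>) * (L * c powr (- 1) * norm x)" .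
    have "S (\<tau> - \<sigma>) ?y = S (\<tau> - c) x" "S c (S (\<tau> - c) x) = S \<tau> x" "S c ?y = S \<sigma> x"
      using S_compose[of c \<sigma> \<tau> x] S_add[of "\<tau> - c" c x] S_add[of "\<sigma> - c" c x] that c by simp_all
    then have eq: "S \<tau> x - S \<sigma> x = S c (S (\<tau> - \<sigma>) ?y - ?y)" using c by simp
    have "N \<gamma> (S c z) \<le> L' * c powr (- \<gamma>) * norm z" for z
      using L'(2)[of c] c by (auto simp: op_bound_def X_0)
    then have "N \<gamma> (S \<tau> x - S \<sigma> x) \<le> L' * c powr (- \<gamma>) * norm (S (\<tau> - \<sigma>) ?y - ?y)"
      unfolding eq .
    also have "\<dots> \<le> L' * c powr (- \<gamma>) * (C * (\<tau> - \<sigma>) * (L * c powr (- 1) * norm x))"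
      using diff L' by (intro mult_left_mono) auto
    finally show ?thesis using that by (simp add: K_def mult_ac)
  qed
  have mem: "S \<tau> x \<in> X \<gamma>" if "2 * c \<le> \<tau>" "\<tau> \<le> T" for \<tau>
    using L'(2)[of \<tau>] that c by (auto simp: op_bound_def X_0)
  have "N \<gamma> (S \<tau> x - S \<sigma> x) \<le> K * \<bar>\<tau> - \<sigma>\<bar>" if "2 * c \<le> \<sigma>" "\<sigma> \<le> T" "2 * c \<le> \<tau>" "\<tau> \<le> T" for \<sigma> \<tau>
    using inc[of \<sigma> \<tau>] inc[of \<tau> \<sigma>] that banach_on_props(6)[OF V mem mem, of \<sigma> \<tau>]
      banach_on_props(4)[OF V]
    by (cases \<sigma> \<tau> rule: linorder_cases) auto
  moreover have "0 \<le> K" using L L' C by (simp add: K_def)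
  ultimately show ?thesis using that by blast
qed

lemma S_mem:
  assumes "0 \<le> \<zeta>" "\<zeta> \<le> \<gamma>" "\<gamma> < 3" "0 < t" "x \<in> X \<zeta>"
  shows "S t x \<in> X \<gamma>"
  using S_smoothing[of t \<zeta> \<gamma>] assms by (force simp: op_bound_def)

text \<open>The difference splits into \<open>S (\<tau> y) (x y - x0)\<close>, bounded by smoothing
  with times away from 0, and the time increment of \<open>S\<close> at the fixed \<open>x0\<close>,
  bounded by the Lipschitz estimate. Positivity of \<open>\<tau>0\<close> matters, as nothing is
  assumed about continuity at time 0.\<close>

lemma S_tendsto:
  assumes \<zeta>\<gamma>: "0 \<le> \<zeta>" "\<zeta> \<le> \<gamma>" "\<gamma> < 3"
    and \<tau>: "(\<tau> \<longlongrightarrow> \<tau>0) F" "0 < \<tau>0"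
    and x: "x0 \<in> X \<zeta>" "\<forall>\<^sub>F y in F. x y \<in> X \<zeta>" "((\<lambda>y. N \<zeta> (x y - x0)) \<longlongrightarrow> 0) F"
  shows "((\<lambda>y. N \<gamma> (S (\<tau> y) (x y) - S \<tau>0 x0)) \<longlongrightarrow> 0) F"
proof -
  have V: "banach_on (X \<gamma>) (N \<gamma>)" and U: "banach_on (X \<zeta>) (N \<zeta>)" using X_banach \<zeta>\<gamma> by auto
  \<comment> \<open>Taking c = \<open>\<tau>0 / 4\<close> gives the window from
    \<open>\<tau>0 / 2\<close> to \<open>2 * \<tau>0\<close>, which eventually contains
    \<open>\<tau> y\<close>.\<close>
  obtain K where K: "0 \<le> K" "\<And>\<sigma> t. \<tau>0 / 2 \<le> \<sigma> \<Longrightarrow> \<sigma> \<le> 2 * \<tau>0 \<Longrightarrow> \<tau>0 / 2 \<le> t \<Longrightarrow> t \<le> 2 * \<tau>0 \<Longrightarrow>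
      N \<gamma> (S t x0 - S \<sigma> x0) \<le> K * \<bar>t - \<sigma>\<bar>"
    using S_time_Lipschitz[of "\<tau>0 / 4" "2 * \<tau>0" \<gamma> x0] \<tau> \<zeta>\<gamma> by auto
  obtain L where L: "0 < L" "\<And>t. 0 < t \<Longrightarrow> t \<le> 2 * \<tau>0 \<Longrightarrow>
      op_bound (X \<zeta>) (N \<zeta>) (X \<gamma>) (N \<gamma>) (S t) (L * t powr (- \<gamma> + \<zeta>))"
    using S_smoothing[of "2 * \<tau>0" \<zeta> \<gamma>] \<tau> \<zeta>\<gamma> by auto
  have near: "\<forall>\<^sub>F y in F. \<tau>0 / 2 < \<tau> y" "\<forall>\<^sub>F y in F. \<tau> y < 2 * \<tau>0"
    using order_tendstoD(1)[OF \<tau>(1), of "\<tau>0 / 2"] order_tendstoD(2)[OF \<tau>(1), of "2 * \<tau>0"] \<tau>(2) by simp_all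
  show ?thesis
  proof (rule tendsto_sandwich)
    show "\<forall>\<^sub>F y in F. 0 \<le> N \<gamma> (S (\<tau> y) (x y) - S \<tau>0 x0)"
      using near(1) x(2)
    proof eventually_elim
      case (elim y)
      then show ?case
        using S_mem[OF \<zeta>\<gamma>, of "\<tau> y" "x y"] S_mem[OF \<zeta>\<gamma> \<tau>(2) x(1)] \<tau>(2)
        by (intro banach_on_props(2)[OF V] subspace_diff[OF banach_on_props(1)[OF V]]) auto
    qed
    show "\<forall>\<^sub>F y in F. N \<gamma> (S (\<tau> y) (x y) - S \<tau>0 x0) \<le>
        L * (\<tau>0 / 2) powr (- \<gamma> + \<zeta>) * N \<zeta> (x y - x0) + K * \<bar>\<tau> y - \<tau>0\<bar>"
      using near x(2)
    proof eventually_elim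
      case (elim y)
      have d: "x y - x0 \<in> X \<zeta>" using elim x(1) subspace_diff[OF banach_on_props(1)[OF U]] by auto
      have "N \<gamma> (S (\<tau> y) (x y - x0)) \<le> L * (\<tau> y) powr (- \<gamma> + \<zeta>) * N \<zeta> (x y - x0)"
        using L(2)[of "\<tau> y"] elim d \<tau>(2) by (auto simp: op_bound_def)
      also have "\<dots> \<le> L * (\<tau>0 / 2) powr (- \<gamma> + \<zeta>) * N \<zeta> (x y - x0)"
        using elim \<zeta>\<gamma> \<tau> L banach_on_props(2)[OF U d]
        by (intro mult_right_mono mult_left_mono powr_mono2') auto
      finally have "N \<gamma> (S (\<tau> y) (x y) - S (\<tau> y) x0) \<le> L * (\<tau>0 / 2) powr (- \<gamma> + \<zeta>) * N \<zeta> (x y - x0)"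
        using elim \<tau>(2) by simp
      moreover have "N \<gamma> (S (\<tau> y) x0 - S \<tau>0 x0) \<le> K * \<bar>\<tau> y - \<tau>0\<bar>"
        using elim \<tau>(2) by (intro K) auto
      moreover have "N \<gamma> (S (\<tau> y) (x y) - S \<tau>0 x0) \<le>
          N \<gamma> (S (\<tau> y) (x y) - S (\<tau> y) x0) + N \<gamma> (S (\<tau> y) x0 - S \<tau>0 x0)"
        using elim \<tau>(2) x(1) by (intro banach_on_diff_triangle[OF V] S_mem[OF \<zeta>\<gamma>]) auto
      ultimately show ?case by simp
    qed
    have "((\<lambda>y. L * (\<tau>0 / 2) powr (- \<gamma> + \<zeta>) * N \<zeta> (x y - x0) + K * \<bar>\<tau> y - \<tau>0\<bar>) \<longlongrightarrow>
        L * (\<tau>0 / 2) powr (- \<gamma> + \<zeta>) * 0 + K * \<bar>\<tau>0 - \<tau>0\<bar>) F"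
      by (intro tendsto_intros x(3) \<tau>(1))
    then show "((\<lambda>y. L * (\<tau>0 / 2) powr (- \<gamma> + \<zeta>) * N \<zeta> (x y - x0) + K * \<bar>\<tau> y - \<tau>0\<bar>) \<longlongrightarrow> 0) F"
      by simp
  qed simp
qed

text \<open>The point inserted in interval k is at distance at least (2^n - k) half-intervals from
  t. The singular factors thus add up to a sum of \<open>j powr - \<epsilon>\<close>, of order 2^(n
  (1 - \<epsilon>)), and the increments of \<open>f\<close> leave a net decay 2^(-n (\<mu> -
  1)).\<close>

lemma dyadic_level_estimate:
  assumes \<alpha>\<epsilon>: "0 \<le> \<alpha>" "0 \<le> \<epsilon>" "\<epsilon> < 1" "\<alpha> + \<epsilon> < 3"
    and L: "0 \<le> L" "\<And>\<tau>. 0 < \<tau> \<Longrightarrow> \<tau> \<le> b - a \<Longrightarrow>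
      op_bound (X \<alpha>) (N \<alpha>) (X (\<alpha> + \<epsilon>)) (N (\<alpha> + \<epsilon>)) (S \<tau>) (L * \<tau> powr - \<epsilon>)"
    and f: "\<And>r s t. a \<le> r \<Longrightarrow> r \<le> s \<Longrightarrow> s \<le> t \<Longrightarrow> t \<le> b \<Longrightarrow>
      f (r, s, t) \<in> X \<alpha> \<and> N \<alpha> (f (r, s, t)) \<le> F * (t - r) powr \<mu>"
    and F: "0 \<le> F" and st: "a \<le> s" "s < t" "t \<le> b"
  shows "dyadic_level f n (s, t) \<in> X (\<alpha> + \<epsilon>)"
    "N (\<alpha> + \<epsilon>) (dyadic_level f n (s, t)) \<le>
      L * F * (2 powr \<epsilon> / (1 - \<epsilon>)) * (t - s) powr (\<mu> - \<epsilon>) * ((1/2) powr (\<mu> - 1)) ^ n"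
proof -
  have V: "banach_on (X (\<alpha> + \<epsilon>)) (N (\<alpha> + \<epsilon>))" using X_banach \<alpha>\<epsilon> by auto
  let ?p = "dyadic s t (Suc n)"
  let ?y = "\<lambda>k. f (?p (2 * k), ?p (2 * k + 1), ?p (2 * k + 2))"
  let ?\<tau> = "\<lambda>k. t - ?p (2 * k + 1)"
  define m where "m = (2::real) ^ n"
  have m: "0 < m" by (simp add: m_def)
  define A where "A = L * F * ((t - s) / m) powr \<mu> * ((t - s) / (2 * m)) powr - \<epsilon>"
  have p: "?p 0 = s" "?p (2 * 2 ^ n) = t" "mono ?p"
    using dyadic_props[of s t "Suc n"] st by simp_all
  have \<tau>: "(t - s) / (2 * m) * real (2 ^ n - k) \<le> ?\<tau> k" "0 < real (2 ^ n - k)" "?\<tau> k \<le> t - s" if "k < 2 ^ n" for k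
  proof -
    have r: "real (2 ^ n - k) = m - real k" using that by (simp add: m_def of_nat_diff)
    have "real (Suc k) \<le> real (2 ^ n)" using that by (subst of_nat_le_iff) simp
    then have km: "real k + 1 \<le> m" by (simp add: m_def)
    \<comment> \<open>The exact distance is 2 j - 1 half-intervals with j = m - k, and 2 j - 1 \<ge>
      j because j \<ge> 1.\<close>
    have "(t - s) / (2 * m) * (m - real k) \<le> (t - s) / (2 * m) * (2 * (m - real k) - 1)"
      using st m km by (intro mult_left_mono) auto
    also have "\<dots> = ?\<tau> k" using m by (simp add: dyadic_def m_def[symmetric] field_simps)
    finally show "(t - s) / (2 * m) * real (2 ^ n - k) \<le> ?\<tau> k" using r by simp
    show "0 < real (2 ^ n - k)" using that by simp
    show "?\<tau> k \<le> t - s" using monoD[OF p(3), of 0 "2 * k + 1"] p by simp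
  qed
  have \<tau>_pos: "0 < ?\<tau> k" if "k < 2 ^ n" for k
  proof -
    have "0 < (t - s) / (2 * m) * real (2 ^ n - k)"
      using \<tau>(2)[OF that] st m by (intro mult_pos_pos divide_pos_pos) auto
    then show ?thesis using \<tau>(1)[OF that] by linarith
  qed
  have summand: "S (?\<tau> k) (?y k) \<in> X (\<alpha> + \<epsilon>) \<and>
      N (\<alpha> + \<epsilon>) (S (?\<tau> k) (?y k)) \<le> A * real (2 ^ n - k) powr - \<epsilon>" if k: "k < 2 ^ n" for k
  proof -
    have "?p (2 * k + 2) \<le> ?p (2 * 2 ^ n)" "?p 0 \<le> ?p (2 * k)" "?p (2 * k) \<le> ?p (2 * k + 1)"
      "?p (2 * k + 1) \<le> ?p (2 * k + 2)"
      using k by (auto intro!: monoD[OF p(3)])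
    moreover have "?p (2 * k + 2) - ?p (2 * k) = (t - s) / m"
      by (simp add: dyadic_def m_def field_simps)
    ultimately have y: "?y k \<in> X \<alpha>" "N \<alpha> (?y k) \<le> F * ((t - s) / m) powr \<mu>"
      using f[of "?p (2 * k)" "?p (2 * k + 1)" "?p (2 * k + 2)"] st p by auto
    have S: "S (?\<tau> k) (?y k) \<in> X (\<alpha> + \<epsilon>)"
      "N (\<alpha> + \<epsilon>) (S (?\<tau> k) (?y k)) \<le> L * ?\<tau> k powr - \<epsilon> * N \<alpha> (?y k)"
      using L(2)[of "?\<tau> k"] \<tau>(3)[OF k] \<tau>_pos[OF k] st y(1) by (auto simp: op_bound_def)
    have "?\<tau> k powr - \<epsilon> \<le> ((t - s) / (2 * m) * real (2 ^ n - k)) powr - \<epsilon>"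
      using \<tau>[OF k] st m \<alpha>\<epsilon> by (intro powr_mono2') auto
    also have "\<dots> = ((t - s) / (2 * m)) powr - \<epsilon> * real (2 ^ n - k) powr - \<epsilon>"
      by (rule powr_mult)
    finally have "L * ?\<tau> k powr - \<epsilon> * N \<alpha> (?y k) \<le>
        L * (((t - s) / (2 * m)) powr - \<epsilon> * real (2 ^ n - k) powr - \<epsilon>) * (F * ((t - s) / m) powr \<mu>)"
      using y L F X_banach[of \<alpha>] \<alpha>\<epsilon> by (intro mult_mono mult_left_mono) (auto intro: banach_on_props(2))
    then show ?thesis using S by (simp add: A_def mult_ac)
  qed
  have level: "dyadic_level f n (s, t) = (\<Sum>k<2^n. S (?\<tau> k) (?y k))"
    by (simp add: dyadic_level_def refinement_sum_def)
  show "dyadic_level f n (s, t) \<in> X (\<alpha> + \<epsilon>)"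
    unfolding level using summand by (intro banach_on_sum_le(1)[OF V]) auto
  have "N (\<alpha> + \<epsilon>) (dyadic_level f n (s, t)) \<le> (\<Sum>k<2^n. N (\<alpha> + \<epsilon>) (S (?\<tau> k) (?y k)))"
    unfolding level using summand by (intro banach_on_sum_le(2)[OF V]) auto
  also have "\<dots> \<le> (\<Sum>k<2^n. A * real (2 ^ n - k) powr - \<epsilon>)"
    using summand by (intro sum_mono) auto
  also have "\<dots> = A * (\<Sum>k<2^n. real (Suc (2 ^ n - Suc k)) powr - \<epsilon>)"
    by (auto simp: sum_distrib_left Suc_diff_Suc intro!: sum.cong)
  also have "\<dots> = A * (\<Sum>i<2^n. real (Suc i) powr - \<epsilon>)"
    by (subst sum.nat_diff_reindex) simp
  also have "\<dots> \<le> A * (real (2 ^ n) powr (1 - \<epsilon>) / (1 - \<epsilon>))"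
    using L F \<alpha>\<epsilon> by (intro mult_left_mono sum_powr_neg_le) (auto simp: A_def)
  \<comment> \<open>The powers of m combine as -\<mu> + \<epsilon> + (1 - \<epsilon>) = 1 - \<mu>;
    the factor \<open>2 powr \<epsilon>\<close> comes from measuring distances in
    half-intervals.\<close>
  also have "\<dots> = L * F * (2 powr \<epsilon> / (1 - \<epsilon>)) * (t - s) powr (\<mu> - \<epsilon>) * m powr (1 - \<mu>)"
    using st m \<alpha>\<epsilon>
    by (simp add: A_def m_def[symmetric] powr_divide powr_mult powr_minus powr_diff field_simps)
  also have "m powr (1 - \<mu>) = (1 / m) powr (\<mu> - 1)"
    using m by (simp add: powr_divide powr_minus[symmetric] powr_diff)
  also have "\<dots> = ((1/2) powr (\<mu> - 1)) ^ n"
    using powr_dyadic[of 1 n "\<mu> - 1"] by (simp add: m_def)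
  finally show "N (\<alpha> + \<epsilon>) (dyadic_level f n (s, t)) \<le>
      L * F * (2 powr \<epsilon> / (1 - \<epsilon>)) * (t - s) powr (\<mu> - \<epsilon>) * ((1/2) powr (\<mu> - 1)) ^ n" .
qed

text \<open>A level is a finite sum, and off the diagonal each semigroup time in it is strictly
  positive, so \<open>S_tendsto\<close> applies to every summand.\<close>

lemma dyadic_level_tendsto:
  assumes \<alpha>\<gamma>: "0 \<le> \<alpha>" "\<alpha> \<le> \<gamma>" "\<gamma> < 3" and f: "f \<in> holder3 (X \<alpha>) (N \<alpha>) \<mu> a b"
    and s0t0: "a \<le> s0" "s0 < t0" "t0 \<le> b"
  shows "((\<lambda>y. N \<gamma> (dyadic_level f n y - dyadic_level f n (s0, t0))) \<longlongrightarrow> 0)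
    (at (s0, t0) within simplex2 a b)"
proof -
  have V: "banach_on (X \<gamma>) (N \<gamma>)" and U: "banach_on (X \<alpha>) (N \<alpha>)" using X_banach \<alpha>\<gamma> by auto
  have f_cont: "continuous_map (top_of_set (simplex3 a b)) (Metric_space.mtopology (X \<alpha>) (ndist (X \<alpha>) (N \<alpha>))) f"
    using f by (simp add: holder3_def)
  define z0 where "z0 = (s0, t0)"
  have z0: "z0 \<in> simplex2 a b" using s0t0 by (simp add: z0_def simplex2_def)
  let ?F = "at z0 within simplex2 a b"
  define p where "p y = dyadic (fst y) (snd y) (Suc n)" for y
  define \<phi> where "\<phi> k y = (p y (2 * k), p y (2 * k + 1), p y (2 * k + 2))" for k y
  define g where "g k y = S (snd y - p y (2 * k + 1)) (f (\<phi> k y))" for k y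
  have level: "dyadic_level f n y = (\<Sum>k<2^n. g k y)" for y
    by (cases y) (simp add: dyadic_level_def refinement_sum_def g_def \<phi>_def p_def)
  have \<phi>_mem: "\<phi> k y \<in> simplex3 a b" if "k < 2 ^ n" "y \<in> simplex2 a b" for k y
  proof -
    have y: "a \<le> fst y" "fst y \<le> snd y" "snd y \<le> b" using that by (auto simp: simplex2_def)
    have mono: "mono (p y)" and ends: "p y 0 = fst y" "p y (2 ^ Suc n) = snd y"
      using dyadic_props[OF y(2), of "Suc n"] by (simp_all add: p_def)
    have "p y 0 \<le> p y (2 * k)" "p y (2 * k) \<le> p y (2 * k + 1)" "p y (2 * k + 1) \<le> p y (2 * k + 2)"
      "p y (2 * k + 2) \<le> p y (2 ^ Suc n)"
      using that by (auto intro!: monoD[OF mono])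
    then show ?thesis using y ends by (simp add: \<phi>_def simplex3_def)
  qed
  have f\<phi>: "f (\<phi> k z) \<in> X \<alpha> \<and> ((\<lambda>y. N \<alpha> (f (\<phi> k y) - f (\<phi> k z))) \<longlongrightarrow> 0) (at z within simplex2 a b)"
    if k: "k < 2 ^ n" and z: "z \<in> simplex2 a b" for k z
  proof -
    have "continuous_map (top_of_set (simplex2 a b)) (top_of_set (simplex3 a b)) (\<phi> k)"
      using \<phi>_mem[OF k] unfolding \<phi>_def p_def dyadic_def
      by (auto intro!: continuous_intros)
    from continuous_map_compose[OF this f_cont] show ?thesis
      using z unfolding continuous_map_ndist_iff[OF U] by simp
  qed
  have pos: "0 < snd z0 - p z0 (2 * k + 1)" if "k < 2 ^ n" for k
  proof -
    have "2 * k + 1 < 2 ^ Suc n" using that by simp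
    then have "real (2 * k + 1) < real (2 ^ Suc n)" by (simp only: of_nat_less_iff)
    then have "real (2 * k + 1) / 2 ^ Suc n < 1" by simp
    then have "(t0 - s0) * (real (2 * k + 1) / 2 ^ Suc n) < (t0 - s0) * 1"
      using s0t0 by (intro mult_strict_left_mono) auto
    then show ?thesis by (simp add: p_def dyadic_def z0_def)
  qed
  have inside: "\<forall>\<^sub>F y in ?F. y \<in> simplex2 a b" by (simp add: eventually_at_filter)
  have time: "((\<lambda>y. snd y - p y (2 * k + 1)) \<longlongrightarrow> snd z0 - p z0 (2 * k + 1)) ?F" for k
    unfolding p_def dyadic_def by (intro tendsto_intros) auto
  \<comment> \<open>On the diagonal these times vanish and \<open>S 0\<close> need not lift into
    \<open>X \<gamma>\<close>; nearby points avoid this case.\<close>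
  have later: "\<forall>\<^sub>F y in ?F. \<forall>k\<in>{..<2^n}. 0 < snd y - p y (2 * k + 1)"
    using order_tendstoD(1)[OF time pos] by (intro eventually_ball_finite) auto
  have g: "((\<lambda>y. N \<gamma> (g k y - g k z0)) \<longlongrightarrow> 0) ?F" if k: "k < 2 ^ n" for k
    unfolding g_def
  proof (rule S_tendsto[OF \<alpha>\<gamma> time pos[OF k]])
    show "\<forall>\<^sub>F y in ?F. f (\<phi> k y) \<in> X \<alpha>"
      using inside by eventually_elim (use f\<phi>[OF k] in blast)
  qed (use f\<phi>[OF k z0] in auto)
  have g_mem: "g k y \<in> X \<gamma>" if "k < 2 ^ n" "y \<in> simplex2 a b" "0 < snd y - p y (2 * k + 1)" for k y
    unfolding g_def using that f\<phi> by (intro S_mem[OF \<alpha>\<gamma>]) auto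
  have "((\<lambda>y. N \<gamma> (dyadic_level f n y - dyadic_level f n z0)) \<longlongrightarrow> 0) ?F"
  proof (rule tendsto_sandwich)
    have mem: "\<forall>\<^sub>F y in ?F. \<forall>k<2^n. g k y - g k z0 \<in> X \<gamma>"
      using inside later
      by eventually_elim (use g_mem pos z0 subspace_diff[OF banach_on_props(1)[OF V]] in auto)
    then show "\<forall>\<^sub>F y in ?F. 0 \<le> N \<gamma> (dyadic_level f n y - dyadic_level f n z0)"
      unfolding level sum_subtractf[symmetric]
      by eventually_elim (intro banach_on_props(2)[OF V] banach_on_sum_le(1)[OF V], auto)
    from mem show "\<forall>\<^sub>F y in ?F. N \<gamma> (dyadic_level f n y - dyadic_level f n z0) \<le> (\<Sum>k<2^n. N \<gamma> (g k y - g k z0))"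
      unfolding level sum_subtractf[symmetric]
      by eventually_elim (intro banach_on_sum_le(2)[OF V], auto)
    show "((\<lambda>y. \<Sum>k<2^n. N \<gamma> (g k y - g k z0)) \<longlongrightarrow> 0) ?F"
      using g by (intro tendsto_null_sum) auto
  qed simp
  then show ?thesis by (simp add: z0_def)
qed

text \<open>The case n = 0 is the norm bound, general n the tail needed for continuity. The constant
  \<open>L\<close> is a parameter so that it can be fixed before the interval is chosen.\<close>

lemma solution_estimate:
  assumes \<alpha>\<epsilon>: "0 \<le> \<alpha>" "\<alpha> < 2" "0 \<le> \<epsilon>" "\<epsilon> < 1" and \<mu>: "1 < \<mu>" and ab: "a < b"
    and f: "f \<in> holder3 (X \<alpha>) (N \<alpha>) \<mu> a b"
    and M: "\<And>s t. a \<le> s \<Longrightarrow> s \<le> t \<Longrightarrow> t \<le> b \<Longrightarrow> (\<lambda>n. dyadic_level f n (s, t)) sums M (s, t)"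
    and L: "0 < L" "\<And>\<tau>. 0 < \<tau> \<Longrightarrow> \<tau> \<le> b - a \<Longrightarrow>
      op_bound (X \<alpha>) (N \<alpha>) (X (\<alpha> + \<epsilon>)) (N (\<alpha> + \<epsilon>)) (S \<tau>) (L * \<tau> powr - \<epsilon>)"
    and st: "a \<le> s" "s < t" "t \<le> b"
  defines "q \<equiv> (1/2) powr (\<mu> - 1)"
  shows "dyadic_level f n (s, t) \<in> X (\<alpha> + \<epsilon>)" "M (s, t) \<in> X (\<alpha> + \<epsilon>)"
    "N (\<alpha> + \<epsilon>) (M (s, t) - (\<Sum>i<n. dyadic_level f i (s, t))) \<le>
      L * holder_norm3 (N \<alpha>) \<mu> a b f * (2 powr \<epsilon> / (1 - \<epsilon>)) * (t - s) powr (\<mu> - \<epsilon>) * q ^ n / (1 - q)"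
proof -
  have V: "banach_on (X (\<alpha> + \<epsilon>)) (N (\<alpha> + \<epsilon>))" and U: "banach_on (X \<alpha>) (N \<alpha>)"
    using X_banach \<alpha>\<epsilon> by auto
  obtain K where K: "\<And>x. x \<in> X (\<alpha> + \<epsilon>) \<Longrightarrow> norm x \<le> K * N (\<alpha> + \<epsilon>) x"
    using norm_le_N[of "\<alpha> + \<epsilon>"] \<alpha>\<epsilon> by auto
  note F = holder3D[OF U ab f]
  have level: "dyadic_level f n (s, t) \<in> X (\<alpha> + \<epsilon>)"
    "N (\<alpha> + \<epsilon>) (dyadic_level f n (s, t)) \<le>
      L * holder_norm3 (N \<alpha>) \<mu> a b f * (2 powr \<epsilon> / (1 - \<epsilon>)) * (t - s) powr (\<mu> - \<epsilon>) * q ^ n" for n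
    unfolding q_def using dyadic_level_estimate[OF \<alpha>\<epsilon>(1,3,4) _ _ L(2) F(2) F(1) st] \<alpha>\<epsilon> L(1) by auto
  have q: "0 \<le> q" "q < 1" using \<mu> half_powr_less_1[of "\<mu> - 1"] by (simp_all add: q_def)
  show "dyadic_level f n (s, t) \<in> X (\<alpha> + \<epsilon>)" by (rule level)
  show "M (s, t) \<in> X (\<alpha> + \<epsilon>)"
    "N (\<alpha> + \<epsilon>) (M (s, t) - (\<Sum>i<n. dyadic_level f i (s, t))) \<le>
      L * holder_norm3 (N \<alpha>) \<mu> a b f * (2 powr \<epsilon> / (1 - \<epsilon>)) * (t - s) powr (\<mu> - \<epsilon>) * q ^ n / (1 - q)"
    using banach_on_sums_geometric[OF V K level q M] st by auto
qed

text \<open>Continuity on the diagonal follows from the Hoelder bound itself, since \<mu> -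
  \<epsilon> > 0. Off the diagonal, \<open>M\<close> is a uniform limit of partial sums that are
  continuous there.\<close>

lemma solution_holder2:
  assumes \<alpha>\<epsilon>: "0 \<le> \<alpha>" "\<alpha> < 2" "0 \<le> \<epsilon>" "\<epsilon> < 1" and \<mu>: "1 < \<mu>" and ab: "a < b"
    and f: "f \<in> holder3 (X \<alpha>) (N \<alpha>) \<mu> a b"
    and M: "\<And>s t. a \<le> s \<Longrightarrow> s \<le> t \<Longrightarrow> t \<le> b \<Longrightarrow> (\<lambda>n. dyadic_level f n (s, t)) sums M (s, t)"
    and M_diag: "\<And>s. a \<le> s \<Longrightarrow> s \<le> b \<Longrightarrow> M (s, s) = 0" and M_ext: "M \<in> extensional (simplex2 a b)"
  shows "M \<in> holder2 (X (\<alpha> + \<epsilon>)) (N (\<alpha> + \<epsilon>)) (\<mu> - \<epsilon>) a b"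
proof -
  let ?\<gamma> = "\<alpha> + \<epsilon>"
  have V: "banach_on (X ?\<gamma>) (N ?\<gamma>)" and U: "banach_on (X \<alpha>) (N \<alpha>)" using X_banach \<alpha>\<epsilon> by auto
  obtain L where L: "0 < L" "\<And>\<tau>. 0 < \<tau> \<Longrightarrow> \<tau> \<le> b - a \<Longrightarrow>
      op_bound (X \<alpha>) (N \<alpha>) (X ?\<gamma>) (N ?\<gamma>) (S \<tau>) (L * \<tau> powr - \<epsilon>)"
    using S_smoothing[of "b - a" \<alpha> ?\<gamma>] ab \<alpha>\<epsilon> by auto
  define q where "q = (1/2::real) powr (\<mu> - 1)"
  have q: "0 \<le> q" "q < 1" using \<mu> half_powr_less_1[of "\<mu> - 1"] by (simp_all add: q_def)
  define B where "B = L * holder_norm3 (N \<alpha>) \<mu> a b f * (2 powr \<epsilon> / (1 - \<epsilon>))"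
  have B: "0 \<le> B" using L holder3D(1)[OF U ab f] \<alpha>\<epsilon> by (simp add: B_def)
  let ?P = "\<lambda>n y. \<Sum>i<n. dyadic_level f i y"
  have level_mem: "dyadic_level f n (s, t) \<in> X ?\<gamma>" and M_mem: "M (s, t) \<in> X ?\<gamma>"
    and tail: "N ?\<gamma> (M (s, t) - ?P n (s, t)) \<le> B * (t - s) powr (\<mu> - \<epsilon>) * q ^ n / (1 - q)"
    if "a \<le> s" "s < t" "t \<le> b" for s t n
    unfolding B_def q_def using solution_estimate[OF \<alpha>\<epsilon> \<mu> ab f M L(1) L(2) that] by blast+
  have M_le: "N ?\<gamma> (M (s, t)) \<le> B / (1 - q) * (t - s) powr (\<mu> - \<epsilon>)" if "a \<le> s" "s < t" "t \<le> b" for s t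
    using tail[OF that, of 0] by simp
  have P_mem: "?P n (s, t) \<in> X ?\<gamma>" if "a \<le> s" "s < t" "t \<le> b" for s t n
    using level_mem[OF that] by (intro banach_on_sum_le(1)[OF V]) auto
  have inside: "\<forall>\<^sub>F y in at z within simplex2 a b. y \<in> simplex2 a b" for z
    by (simp add: eventually_at_filter)
  have M_mem': "M y \<in> X ?\<gamma>" if "y \<in> simplex2 a b" for y
    using that M_mem M_diag subspace_0[OF banach_on_props(1)[OF V]]
    by (cases "fst y = snd y") (auto simp: simplex2_def)
  have M_cont: "((\<lambda>y. N ?\<gamma> (M y - M (s0, t0))) \<longlongrightarrow> 0) (at (s0, t0) within simplex2 a b)" (is "(_ \<longlongrightarrow> _) ?F")
    if st0: "a \<le> s0" "s0 \<le> t0" "t0 \<le> b" for s0 t0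
  proof (cases "s0 = t0")
    case True
    have gap: "((\<lambda>y. snd y - fst y) \<longlongrightarrow> snd (s0, t0) - fst (s0, t0)) ?F"
      by (intro tendsto_intros)
    show ?thesis
    proof (rule tendsto_sandwich)
      show "\<forall>\<^sub>F y in ?F. 0 \<le> N ?\<gamma> (M y - M (s0, t0))"
        using inside
        by eventually_elim (use st0 in \<open>auto intro!: banach_on_props(2)[OF V]
          subspace_diff[OF banach_on_props(1)[OF V]] M_mem' simp: simplex2_def\<close>)
      show "\<forall>\<^sub>F y in ?F. N ?\<gamma> (M y - M (s0, t0)) \<le> B / (1 - q) * (snd y - fst y) powr (\<mu> - \<epsilon>)"
        using inside
      proof eventually_elim
        case (elim y)
        then show ?case
          using M_le[of "fst y" "snd y"] M_diag st0 True banach_on_props(4)[OF V]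
          by (cases "fst y = snd y") (auto simp: simplex2_def)
      qed
      have "((\<lambda>y. (snd y - fst y) powr (\<mu> - \<epsilon>)) \<longlongrightarrow> (snd (s0, t0) - fst (s0, t0)) powr (\<mu> - \<epsilon>)) ?F"
      proof (rule tendsto_powr2[OF gap tendsto_const])
        show "\<forall>\<^sub>F y in ?F. 0 \<le> snd y - fst y"
          using inside by eventually_elim (auto simp: simplex2_def)
      qed (use \<mu> \<alpha>\<epsilon> in simp)
      then show "((\<lambda>y. B / (1 - q) * (snd y - fst y) powr (\<mu> - \<epsilon>)) \<longlongrightarrow> 0) ?F"
        using True by (intro tendsto_mult_right_zero) simp
    qed simp
  next
    case False
    then have lt0: "s0 < t0" using st0 by simp
    \<comment> \<open>Replacing t - s by b - a makes the tail bound independent of the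
      point.\<close>
    define E where "E = B * (b - a) powr (\<mu> - \<epsilon>)"
    have tail': "N ?\<gamma> (M (s, t) - ?P n (s, t)) \<le> E * q ^ n / (1 - q)" if "a \<le> s" "s < t" "t \<le> b" for s t n
    proof -
      have "B * (t - s) powr (\<mu> - \<epsilon>) * q ^ n / (1 - q) \<le> E * q ^ n / (1 - q)"
        unfolding E_def using B q that \<mu> \<alpha>\<epsilon>
        by (intro divide_right_mono mult_right_mono mult_left_mono powr_mono2) auto
      then show ?thesis using tail[OF that, of n] by linarith
    qed
    have E_lim: "(\<lambda>n. E * q ^ n / (1 - q)) \<longlonglongrightarrow> 0"
      using q by (intro tendsto_divide_zero tendsto_mult_right_zero LIMSEQ_power_zero) auto
    show ?thesis
    proof (rule tendstoI)
      fix e :: real assume "0 < e"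
      \<comment> \<open>One third of e for each tail and one third for the difference of the partial
        sums, whose finitely many levels are continuous.\<close>
      then obtain n where n: "E * q ^ n / (1 - q) < e / 3"
        using order_tendstoD(2)[OF E_lim, of "e / 3"] by (auto simp: eventually_sequentially)
      have order: "\<forall>\<^sub>F y in ?F. 0 < snd y - fst y"
      proof (rule order_tendstoD(1))
        show "((\<lambda>y. snd y - fst y) \<longlongrightarrow> snd (s0, t0) - fst (s0, t0)) ?F"
          by (intro tendsto_intros)
      qed (use lt0 in simp)
      have levels: "((\<lambda>y. \<Sum>i<n. N ?\<gamma> (dyadic_level f i y - dyadic_level f i (s0, t0))) \<longlongrightarrow> 0) ?F"
        using \<alpha>\<epsilon> st0 lt0 by (intro tendsto_null_sum dyadic_level_tendsto[OF _ _ _ f]) auto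
      have "\<forall>\<^sub>F y in ?F. (\<Sum>i<n. N ?\<gamma> (dyadic_level f i y - dyadic_level f i (s0, t0))) < e / 3"
        using order_tendstoD(2)[OF levels, of "e / 3"] \<open>0 < e\<close> by simp
      with inside order show "\<forall>\<^sub>F y in ?F. dist (N ?\<gamma> (M y - M (s0, t0))) 0 < e"
      proof eventually_elim
        case (elim y)
        obtain s t where y: "y = (s, t)" by (cases y)
        have st: "a \<le> s" "s < t" "t \<le> b" using elim by (auto simp: y simplex2_def)
        note mem = M_mem[OF st] M_mem[OF st0(1) lt0 st0(3)] P_mem[OF st, of n]
          P_mem[OF st0(1) lt0 st0(3), of n]
        have "?P n y - ?P n (s0, t0) = (\<Sum>i<n. dyadic_level f i y - dyadic_level f i (s0, t0))"
          by (simp add: sum_subtractf)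
        also have "N ?\<gamma> \<dots> \<le> (\<Sum>i<n. N ?\<gamma> (dyadic_level f i y - dyadic_level f i (s0, t0)))"
          using level_mem[OF st] level_mem[OF st0(1) lt0 st0(3)] unfolding y
          by (intro banach_on_sum_le(2)[OF V] subspace_diff[OF banach_on_props(1)[OF V]])
        finally have "N ?\<gamma> (?P n y - ?P n (s0, t0)) < e / 3" using elim by simp
        moreover have "N ?\<gamma> (M y - ?P n y) < e / 3" using tail'[OF st, of n] n unfolding y by linarith
        moreover have "N ?\<gamma> (?P n (s0, t0) - M (s0, t0)) < e / 3"
          using tail'[OF st0(1) lt0 st0(3), of n] n banach_on_props(6)[OF V mem(4) mem(2)] by linarith
        moreover have "N ?\<gamma> (M y - M (s0, t0)) \<le>
            N ?\<gamma> (M y - ?P n y) + (N ?\<gamma> (?P n y - ?P n (s0, t0)) + N ?\<gamma> (?P n (s0, t0) - M (s0, t0)))"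
          using banach_on_diff_triangle[OF V mem(1,3,2)] banach_on_diff_triangle[OF V mem(3,4,2)] y by simp
        moreover have "0 \<le> N ?\<gamma> (M y - M (s0, t0))"
          using mem y by (auto intro!: banach_on_props(2)[OF V] subspace_diff[OF banach_on_props(1)[OF V]])
        ultimately show ?case by simp
      qed
    qed
  qed
  have "continuous_map (top_of_set (simplex2 a b)) (Metric_space.mtopology (X ?\<gamma>) (ndist (X ?\<gamma>) (N ?\<gamma>))) M"
    unfolding continuous_map_ndist_iff[OF V] using M_mem' M_cont by (auto simp: simplex2_def)
  moreover have "bdd_above (quotients2 (N ?\<gamma>) (\<mu> - \<epsilon>) a b M)"
    by (rule holder_norm2_le(1)[OF ab]) (rule M_le)
  ultimately show ?thesis using M_ext M_diag by (simp add: holder2_def)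
qed

section \<open>Uniqueness, existence and the norm bound\<close>

lemma holder2_solution_sums:
  assumes \<alpha>: "0 \<le> \<alpha>" "\<alpha> < 3" and \<mu>: "1 < \<mu>"
    and M: "M \<in> holder2 (X \<alpha>) (N \<alpha>) \<mu> a b" "solves a b f M"
    and st: "a \<le> s" "s \<le> t" "t \<le> b"
  shows "(\<lambda>n. dyadic_level f n (s, t)) sums M (s, t)"
proof -
  have V: "banach_on (X \<alpha>) (N \<alpha>)" using X_banach \<alpha> .
  obtain K where K: "0 < K" "\<And>x. x \<in> X \<alpha> \<Longrightarrow> norm x \<le> K * N \<alpha> x"
    using norm_le_N \<alpha> by blast
  obtain B where B: "\<And>q. q \<in> quotients2 (N \<alpha>) \<mu> a b M \<Longrightarrow> q \<le> B"
    using M(1) by (auto simp: holder2_def bdd_above_def)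
  have "norm (M (u, v)) \<le> K * max B 0 * (v - u) powr \<mu>" if "a \<le> u" "u \<le> v" "v \<le> b" for u v
  proof (cases "u = v")
    case True
    then show ?thesis using M(1) that by (simp add: holder2_def)
  next
    case False
    have "continuous_map (top_of_set (simplex2 a b)) (Metric_space.mtopology (X \<alpha>) (ndist (X \<alpha>) (N \<alpha>))) M"
      using M(1) by (simp add: holder2_def)
    then have "M (u, v) \<in> X \<alpha>"
      using that unfolding continuous_map_ndist_iff[OF V] by (auto simp: simplex2_def)
    then have "norm (M (u, v)) \<le> K * N \<alpha> (M (u, v))" by (rule K)
    also have "N \<alpha> (M (u, v)) * (v - u) powr - \<mu> \<le> B"
      using False that unfolding quotients2_def by (intro B[unfolded quotients2_def] CollectI exI[of _ u] exI[of _ v]) auto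
    then have "N \<alpha> (M (u, v)) \<le> B * (v - u) powr \<mu>"
      using False that by (simp add: powr_minus divide_simps)
    \<comment> \<open>\<open>B\<close> is any upper bound of the quotients, with no sign known,
      whereas \<open>sums_dyadic_level\<close> takes a nonnegative constant.\<close>
    then have "N \<alpha> (M (u, v)) \<le> max B 0 * (v - u) powr \<mu>"
      by (rule order_trans) (intro mult_right_mono, auto)
    finally show ?thesis using K(1) by (simp add: mult.assoc)
  qed
  then show ?thesis
    using K(1) by (intro sums_dyadic_level[OF M(2) \<mu> _ _ st, of "K * max B 0"]) auto
qed

lemma solution_unique_existence:
  assumes \<alpha>: "0 \<le> \<alpha>" "\<alpha> < 2" and \<mu>: "1 < \<mu>" and ab: "a < b"
    and f: "f \<in> holder3 (X \<alpha>) (N \<alpha>) \<mu> a b"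
    and cocycle: "\<forall>p\<in>simplex4 a b. delta_S3 S f p = 0"
  shows "\<exists>!M. M \<in> (\<Inter>\<epsilon>\<in>{0..<1}. holder2 (X (\<alpha> + \<epsilon>)) (N (\<alpha> + \<epsilon>)) (\<mu> - \<epsilon>) a b) \<and> solves a b f M"
proof (rule ex_ex1I)
  have U: "banach_on (X \<alpha>) (N \<alpha>)" using X_banach \<alpha> by simp
  note F = holder3D[OF U ab f]
  obtain K where K: "0 < K" "\<And>x. x \<in> X \<alpha> \<Longrightarrow> norm x \<le> K * N \<alpha> x"
    using norm_le_N[of \<alpha>] \<alpha> by auto
  have norm_f: "norm (f (r, s, t)) \<le> K * holder_norm3 (N \<alpha>) \<mu> a b f * (t - r) powr \<mu>"
    if "a \<le> r" "r \<le> s" "s \<le> t" "t \<le> b" for r s t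
  proof -
    have "norm (f (r, s, t)) \<le> K * N \<alpha> (f (r, s, t))" using F(2)[OF that] K by blast
    also have "\<dots> \<le> K * (holder_norm3 (N \<alpha>) \<mu> a b f * (t - r) powr \<mu>)"
      using F(2)[OF that] K by (intro mult_left_mono) auto
    finally show ?thesis by (simp add: mult.assoc)
  qed
  obtain M C \<kappa> where M: "solves a b f M" "1 < \<kappa>" "0 \<le> C"
    "\<And>s t. a \<le> s \<Longrightarrow> s \<le> t \<Longrightarrow> t \<le> b \<Longrightarrow> norm (M (s, t)) \<le> C * (t - s) powr \<kappa>"
    by (rule sewing_exists[OF ab \<mu> norm_f _ F(3) cocycle]) (use F(1) K(1) in auto)
  \<comment> \<open>The sewn solution is cut down to the simplex, as membership in
    \<open>holder2\<close> includes being extensional.\<close>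
  define M' where "M' = restrict M (simplex2 a b)"
  have M': "M' (s, t) = M (s, t)" if "a \<le> s" "s \<le> t" "t \<le> b" for s t
    using that by (simp add: M'_def simplex2_def)
  have "solves a b f M'"
    using M(1) unfolding solves_def by (auto simp: simplex3_def delta_hat2_def M')
  moreover have "M' \<in> holder2 (X (\<alpha> + \<epsilon>)) (N (\<alpha> + \<epsilon>)) (\<mu> - \<epsilon>) a b" if "\<epsilon> \<in> {0..<1}" for \<epsilon>
  proof (rule solution_holder2[OF \<alpha> _ _ \<mu> ab f])
    show "(\<lambda>n. dyadic_level f n (s, t)) sums M' (s, t)" if "a \<le> s" "s \<le> t" "t \<le> b" for s t
      using sums_dyadic_level[OF M that] M'[OF that] by simp
    show "M' (s, s) = 0" if "a \<le> s" "s \<le> b" for s using M(4)[of s s] M'[of s s] that by simp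
  qed (use that in \<open>auto simp: M'_def\<close>)
  ultimately show "\<exists>M. M \<in> (\<Inter>\<epsilon>\<in>{0..<1}. holder2 (X (\<alpha> + \<epsilon>)) (N (\<alpha> + \<epsilon>)) (\<mu> - \<epsilon>) a b) \<and> solves a b f M"
    by blast
next
  fix M M'
  assume "M \<in> (\<Inter>\<epsilon>\<in>{0..<1}. holder2 (X (\<alpha> + \<epsilon>)) (N (\<alpha> + \<epsilon>)) (\<mu> - \<epsilon>) a b) \<and> solves a b f M"
    and "M' \<in> (\<Inter>\<epsilon>\<in>{0..<1}. holder2 (X (\<alpha> + \<epsilon>)) (N (\<alpha> + \<epsilon>)) (\<mu> - \<epsilon>) a b) \<and> solves a b f M'"
  \<comment> \<open>The member \<epsilon> = 0 of the intersection already forces uniqueness: it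
    gives an ambient bound of exponent \<mu> > 1, hence the dyadic expansion.\<close>
  then have M: "M \<in> holder2 (X \<alpha>) (N \<alpha>) \<mu> a b" "solves a b f M"
    and M': "M' \<in> holder2 (X \<alpha>) (N \<alpha>) \<mu> a b" "solves a b f M'"
    by (auto dest!: bspec[of _ _ "0::real"])
  show "M = M'"
  proof (rule extensionalityI)
    show "M \<in> extensional (simplex2 a b)" "M' \<in> extensional (simplex2 a b)"
      using M M' by (simp_all add: holder2_def)
    fix y assume "y \<in> simplex2 a b"
    then obtain s t where "y = (s, t)" "a \<le> s" "s \<le> t" "t \<le> b" by (auto simp: simplex2_def)
    then show "M y = M' y"
      using holder2_solution_sums[OF \<alpha>(1) _ \<mu> M, of s t] holder2_solution_sums[OF \<alpha>(1) _ \<mu> M', of s t] \<alpha>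
      by (auto intro: sums_unique2)
  qed
qed

text \<open>The smoothing constant is taken on (0, l], so \<open>C\<close> depends on the interval
  only through its length and is chosen before \<open>f\<close> and \<open>M\<close>.\<close>

lemma solution_norm_bound:
  assumes \<alpha>\<epsilon>: "0 \<le> \<alpha>" "\<alpha> < 2" "0 \<le> \<epsilon>" "\<epsilon> < 1" and \<mu>: "1 < \<mu>" and l: "0 < l"
  shows "\<exists>C>0. \<forall>a b f M. b - a = l \<longrightarrow> f \<in> holder3 (X \<alpha>) (N \<alpha>) \<mu> a b \<longrightarrow>
    M \<in> holder2 (X \<alpha>) (N \<alpha>) \<mu> a b \<longrightarrow> solves a b f M \<longrightarrow>
    holder_norm2 (N (\<alpha> + \<epsilon>)) (\<mu> - \<epsilon>) a b M \<le> C * holder_norm3 (N \<alpha>) \<mu> a b f"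
proof -
  obtain L where L: "0 < L" "\<And>\<tau>. 0 < \<tau> \<Longrightarrow> \<tau> \<le> l \<Longrightarrow>
      op_bound (X \<alpha>) (N \<alpha>) (X (\<alpha> + \<epsilon>)) (N (\<alpha> + \<epsilon>)) (S \<tau>) (L * \<tau> powr - \<epsilon>)"
    using S_smoothing[of l \<alpha> "\<alpha> + \<epsilon>"] l \<alpha>\<epsilon> by auto
  define q where "q = (1/2::real) powr (\<mu> - 1)"
  have q: "q < 1" using \<mu> half_powr_less_1[of "\<mu> - 1"] by (simp add: q_def)
  define C where "C = L * (2 powr \<epsilon> / (1 - \<epsilon>)) / (1 - q)"
  have "0 < C" using L q \<alpha>\<epsilon> by (simp add: C_def)
  moreover have "holder_norm2 (N (\<alpha> + \<epsilon>)) (\<mu> - \<epsilon>) a b M \<le> C * holder_norm3 (N \<alpha>) \<mu> a b f"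
    if ab: "b - a = l" and f: "f \<in> holder3 (X \<alpha>) (N \<alpha>) \<mu> a b"
      and M: "M \<in> holder2 (X \<alpha>) (N \<alpha>) \<mu> a b" "solves a b f M" for a b f M
  proof (rule holder_norm2_le(2))
    have "a < b" using ab l by simp
    then show "a < b" .
    fix s t assume st: "a \<le> s" "s < t" "t \<le> b"
    have "N (\<alpha> + \<epsilon>) (M (s, t) - (\<Sum>i<0. dyadic_level f i (s, t))) \<le>
      L * holder_norm3 (N \<alpha>) \<mu> a b f * (2 powr \<epsilon> / (1 - \<epsilon>)) * (t - s) powr (\<mu> - \<epsilon>) * q ^ 0 / (1 - q)"
      unfolding q_def using L \<alpha>\<epsilon> ab
      by (intro solution_estimate[OF \<alpha>\<epsilon> \<mu> \<open>a < b\<close> f _ L(1) _ st]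
          holder2_solution_sums[OF _ _ \<mu> M]) auto
    then show "N (\<alpha> + \<epsilon>) (M (s, t)) \<le> C * holder_norm3 (N \<alpha>) \<mu> a b f * (t - s) powr (\<mu> - \<epsilon>)"
      by (simp add: C_def mult_ac)
  qed
  ultimately show ?thesis by blast
qed

end

theorem proposition2p8:
  fixes X :: "real \<Rightarrow> 'a::banach set"
    and N :: "real \<Rightarrow> 'a \<Rightarrow> real"
    and D :: "'a set"
    and A :: "'a \<Rightarrow> 'a"
    and S :: "real \<Rightarrow> 'a \<Rightarrow> 'a"
    and \<mu> \<alpha> :: real
  assumes "smoothing_semigroup X N D A S"
    and "1 < \<mu>"
    and "0 \<le> \<alpha>" and "\<alpha> < 2"
  shows "(\<forall>a b f. a < b \<longrightarrow> f \<in> holder3 (X \<alpha>) (N \<alpha>) \<mu> a b \<longrightarrow>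
            (\<forall>p\<in>simplex4 a b. delta_S3 S f p = 0) \<longrightarrow>
            (\<exists>!M. M \<in> (\<Inter>\<epsilon>\<in>{0..<1}. holder2 (X (\<alpha> + \<epsilon>)) (N (\<alpha> + \<epsilon>)) (\<mu> - \<epsilon>) a b) \<and>
                  (\<forall>p\<in>simplex3 a b. delta_hat2 S M p = S_op3 S f p)))
       \<and> (\<forall>\<epsilon>\<in>{0..<1}. \<forall>l>0. \<exists>C>0. \<forall>a b f M. b - a = l \<longrightarrow>
            f \<in> holder3 (X \<alpha>) (N \<alpha>) \<mu> a b \<longrightarrow>
            (\<forall>p\<in>simplex4 a b. delta_S3 S f p = 0) \<longrightarrow>
            M \<in> (\<Inter>\<epsilon>'\<in>{0..<1}. holder2 (X (\<alpha> + \<epsilon>')) (N (\<alpha> + \<epsilon>')) (\<mu> - \<epsilon>') a b) \<longrightarrow>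
            (\<forall>p\<in>simplex3 a b. delta_hat2 S M p = S_op3 S f p) \<longrightarrow>
            holder_norm2 (N (\<alpha> + \<epsilon>)) (\<mu> - \<epsilon>) a b M \<le> C * holder_norm3 (N \<alpha>) \<mu> a b f)"
proof -
  interpret smoothing_semigroup X N D A S by fact
  note \<mu>\<alpha> = assms(2-4)
  show ?thesis
  proof (intro conjI allI impI ballI)
    fix a b f
    assume "a < b" "f \<in> holder3 (X \<alpha>) (N \<alpha>) \<mu> a b" "\<forall>p\<in>simplex4 a b. delta_S3 S f p = 0"
    then show "\<exists>!M. M \<in> (\<Inter>\<epsilon>\<in>{0..<1}. holder2 (X (\<alpha> + \<epsilon>)) (N (\<alpha> + \<epsilon>)) (\<mu> - \<epsilon>) a b) \<and>
        (\<forall>p\<in>simplex3 a b. delta_hat2 S M p = S_op3 S f p)"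
      using solution_unique_existence[of \<alpha> \<mu> a b f] \<mu>\<alpha> unfolding solves_def by blast
  next
    fix \<epsilon> l :: real assume \<epsilon>: "\<epsilon> \<in> {0..<1}" and l: "0 < l"
    obtain C where C: "0 < C" "\<And>a b f M. b - a = l \<Longrightarrow> f \<in> holder3 (X \<alpha>) (N \<alpha>) \<mu> a b \<Longrightarrow>
        M \<in> holder2 (X \<alpha>) (N \<alpha>) \<mu> a b \<Longrightarrow> solves a b f M \<Longrightarrow>
        holder_norm2 (N (\<alpha> + \<epsilon>)) (\<mu> - \<epsilon>) a b M \<le> C * holder_norm3 (N \<alpha>) \<mu> a b f"
      using solution_norm_bound[of \<alpha> \<epsilon> \<mu> l] \<mu>\<alpha> \<epsilon> l by auto
    have zero: "M \<in> holder2 (X \<alpha>) (N \<alpha>) \<mu> a b"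
      if "M \<in> (\<Inter>\<epsilon>'\<in>{0..<1}. holder2 (X (\<alpha> + \<epsilon>')) (N (\<alpha> + \<epsilon>')) (\<mu> - \<epsilon>') a b)" for M a b
      using INT_D[OF that, of 0] by simp
    show "\<exists>C>0. \<forall>a b f M. b - a = l \<longrightarrow>
            f \<in> holder3 (X \<alpha>) (N \<alpha>) \<mu> a b \<longrightarrow>
            (\<forall>p\<in>simplex4 a b. delta_S3 S f p = 0) \<longrightarrow>
            M \<in> (\<Inter>\<epsilon>'\<in>{0..<1}. holder2 (X (\<alpha> + \<epsilon>')) (N (\<alpha> + \<epsilon>')) (\<mu> - \<epsilon>') a b) \<longrightarrow>
            (\<forall>p\<in>simplex3 a b. delta_hat2 S M p = S_op3 S f p) \<longrightarrow>
            holder_norm2 (N (\<alpha> + \<epsilon>)) (\<mu> - \<epsilon>) a b M \<le> C * holder_norm3 (N \<alpha>) \<mu> a b f"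
      using C zero unfolding solves_def by (intro exI[of _ C] conjI allI impI) auto
  qed
qed

end
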